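(* Let $p$ be a prime and let $G$ be a finite $p$-group. Then $\lambda(\Gamma_G) = |G|$ if and only if $G$ is neither cyclic nor a generalized quaternion $2$-group.
   Context: A finite group $G$ is a $p$-group ($p$ prime) if $|G| = p^n$ for some integer $n \geq 1$. The power graph $\Gamma_G$ of a finite group $G$ is the simple undirected graph with vertex set $G$ in which two distinct vertices $a, b$ are adjacent if and only if $a = b^n$ or $b = a^m$ for some positive integers $m, n$. For a finite simple undirected graph $\Gamma$ with vertex set $V(\Gamma)$, let $d(a,b)$ denote the length of the shortest path joining the vertices $a$ and $b$. An $L(2,1)$-labelling of $\Gamma$ is a function $f : V(\Gamma) \to \mathbb{Z}$ such that $|f(a) - f(b)| \geq 2$ whenever $d(a,b) = 1$, and $|f(a) - f(b)| \geq 1$ whenever $d(a,b) = 2$. Its span is $\mathrm{span}(f) = \max_{x \in V(\Gamma)} f(x) - \min_{x \in V(\Gamma)} f(x)$. The lambda number is $\lambda(\Gamma) = \min\{\mathrm{span}(f) : f \text{ is an } L(2,1)\text{-labelling of } \Gamma\}$. A generalized quaternion $2$-group is a group isomorphic to $\mathbb{Q}_{2^{e+1}} = \langle x, y : x^{2^e} = 1,\ x^{2^{e-1}} = y^2,\ y^{-1}xy = x^{-1} \rangle$ (of order $2^{e+1}$) for some integer $e \geq 2$.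
   Formalization: The group of order 2 is excluded: it is cyclic, yet its power graph is a single edge with lambda number 2 = |G|, so the equivalence as stated fails there; all other finite p-groups are covered. *)

theory Defs
  imports
    "HOL-Algebra.Elementary_Groups"
    "HOL-Computational_Algebra.Primes"
    "HOL-Library.Extended_Nat"
    "Graph_Theory.Pair_Digraph"
begin

section \<open>Distance and L(2,1)-labellings\<close>

text \<open>
  Finite simple undirected graphs are the symmetric digraphs of the locale
  \<^locale>\<open>graph\<close>, in which each edge appears as a pair of opposite arcs.
  The distance is \<open>\<infinity>\<close> for vertices not joined by a path.
\<close>

definition graph_dist :: "('a, 'b) pre_digraph \<Rightarrow> 'a \<Rightarrow> 'a \<Rightarrow> enat" where
  "graph_dist \<Gamma> a b = (INF p \<in> {p. pre_digraph.apath \<Gamma> a p b}. enat (length p))"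

lemma graph_dist_self:
  assumes "a \<in> verts \<Gamma>"
  shows "graph_dist \<Gamma> a a = 0"
proof -
  have "pre_digraph.apath \<Gamma> a [] a"
    using assms by (simp add: pre_digraph.apath_def pre_digraph.awalk_def
        pre_digraph.cas.simps pre_digraph.awalk_verts.simps)
  then have "graph_dist \<Gamma> a a \<le> enat (length ([] :: 'b list))"
    unfolding graph_dist_def by (intro INF_lower) simp
  then show ?thesis by (simp add: zero_enat_def[symmetric])
qed

definition L21_labelling :: "('a, 'b) pre_digraph \<Rightarrow> ('a \<Rightarrow> int) \<Rightarrow> bool" where
  "L21_labelling \<Gamma> f \<longleftrightarrow>
     (\<forall>a \<in> verts \<Gamma>. \<forall>b \<in> verts \<Gamma>.
        (graph_dist \<Gamma> a b = 1 \<longrightarrow> \<bar>f a - f b\<bar> \<ge> 2) \<and>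
        (graph_dist \<Gamma> a b = 2 \<longrightarrow> \<bar>f a - f b\<bar> \<ge> 1))"

definition label_span :: "('a, 'b) pre_digraph \<Rightarrow> ('a \<Rightarrow> int) \<Rightarrow> int" where
  "label_span \<Gamma> f = Max (f ` verts \<Gamma>) - Min (f ` verts \<Gamma>)"

definition lambda_number :: "('a, 'b) pre_digraph \<Rightarrow> int" where
  "lambda_number \<Gamma> = (LEAST k. \<exists>f. L21_labelling \<Gamma> f \<and> k = label_span \<Gamma> f)"

text \<open>The minimum exists for finite nonempty graphs, so the \<open>LEAST\<close> above is a genuine minimum.\<close>

lemma lambda_number_attained:
  assumes "finite (verts \<Gamma>)" and "verts \<Gamma> \<noteq> {}"
  shows "\<exists>f. L21_labelling \<Gamma> f \<and> lambda_number \<Gamma> = label_span \<Gamma> f \<and>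
    (\<forall>g. L21_labelling \<Gamma> g \<longrightarrow> label_span \<Gamma> f \<le> label_span \<Gamma> g)"
proof -
  obtain h :: "'a \<Rightarrow> nat" where h: "inj_on h (verts \<Gamma>)"
    using finite_imp_inj_to_nat_seg[OF assms(1)] by blast
  have self: "graph_dist \<Gamma> a a = 0" if "a \<in> verts \<Gamma>" for a
    by (rule graph_dist_self[OF that])
  have "L21_labelling \<Gamma> (\<lambda>a. 2 * int (h a))"
    unfolding L21_labelling_def
  proof (intro ballI)
    fix a b assume ab: "a \<in> verts \<Gamma>" "b \<in> verts \<Gamma>"
    show "(graph_dist \<Gamma> a b = 1 \<longrightarrow> \<bar>2 * int (h a) - 2 * int (h b)\<bar> \<ge> 2) \<and>
        (graph_dist \<Gamma> a b = 2 \<longrightarrow> \<bar>2 * int (h a) - 2 * int (h b)\<bar> \<ge> 1)"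
    proof (cases "a = b")
      case False
      then have "h a \<noteq> h b" using h ab by (auto dest: inj_onD)
      then have "\<bar>2 * int (h a) - 2 * int (h b)\<bar> \<ge> 2" by linarith
      then show ?thesis by simp
    qed (use ab self in auto)
  qed
  then obtain f where f: "L21_labelling \<Gamma> f"
    and min: "\<And>g. L21_labelling \<Gamma> g \<Longrightarrow> nat (label_span \<Gamma> f) \<le> nat (label_span \<Gamma> g)"
    using ex_has_least_nat[of "L21_labelling \<Gamma>" _ "\<lambda>f. nat (label_span \<Gamma> f)"] by blast
  have "0 \<le> label_span \<Gamma> g" for g
  proof -
    obtain a where "a \<in> verts \<Gamma>" using assms(2) by blast
    then have "Min (g ` verts \<Gamma>) \<le> g a" "g a \<le> Max (g ` verts \<Gamma>)"
      using assms(1) by auto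
    then show ?thesis by (simp add: label_span_def)
  qed
  then have le: "label_span \<Gamma> f \<le> label_span \<Gamma> g" if "L21_labelling \<Gamma> g" for g
    using min[OF that] by (simp add: nat_le_eq_zle)
  then have "lambda_number \<Gamma> = label_span \<Gamma> f"
    unfolding lambda_number_def using f by (intro Least_equality) auto
  then show ?thesis using f le by blast
qed


section \<open>Power graphs\<close>

definition power_graph :: "('a, 'm) monoid_scheme \<Rightarrow> ('a, 'a \<times> 'a) pre_digraph" where
  "power_graph G = with_proj
     \<lparr> pverts = carrier G,
       parcs = {(a, b). a \<in> carrier G \<and> b \<in> carrier G \<and> a \<noteq> b \<and>
         ((\<exists>n::nat. n > 0 \<and> a = b [^]\<^bsub>G\<^esub> n) \<or> (\<exists>m::nat. m > 0 \<and> b = a [^]\<^bsub>G\<^esub> m))} \<rparr>"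

lemma verts_power_graph [simp]: "verts (power_graph G) = carrier G"
  by (simp add: power_graph_def)

lemma graph_power_graph:
  assumes "finite (carrier G)"
  shows "graph (power_graph G)"
proof -
  have "arcs (power_graph G) \<subseteq> carrier G \<times> carrier G"
    by (auto simp: power_graph_def)
  then have fin: "finite (arcs (power_graph G))"
    using assms finite_subset by blast
  show ?thesis
    by unfold_locales
      (use assms fin in \<open>auto simp: power_graph_def arc_to_ends_def symmetric_def sym_def\<close>)
qed


text \<open>
  The group of order 2 is cyclic, but its power graph is a single edge, whose lambda number is 2.
  It is the only nontrivial cyclic group of prime power order whose lambda number equals its order.
\<close>

lemma graph_dist_adjacent:
  assumes "e \<in> arcs \<Gamma>" "tail \<Gamma> e = a" "head \<Gamma> e = b" "a \<in> verts \<Gamma>" "a \<noteq> b"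
  shows "graph_dist \<Gamma> a b = 1"
proof (rule antisym)
  have "pre_digraph.apath \<Gamma> a [e] b"
    using assms by (simp add: pre_digraph.apath_def pre_digraph.awalk_def
        pre_digraph.cas.simps pre_digraph.awalk_verts.simps)
  then have "graph_dist \<Gamma> a b \<le> enat (length [e])"
    unfolding graph_dist_def by (intro INF_lower) simp
  then show "graph_dist \<Gamma> a b \<le> 1" by (simp add: one_enat_def)
  have "1 \<le> enat (length p)" if "pre_digraph.apath \<Gamma> a p b" for p
    using that assms(5)
    by (cases p) (auto simp: pre_digraph.apath_def pre_digraph.awalk_def
        pre_digraph.cas.simps one_enat_def)
  then show "1 \<le> graph_dist \<Gamma> a b"
    unfolding graph_dist_def by (intro INF_greatest) simp
qed

lemma lambda_number_power_graph_order_2: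
  assumes "group G" and "order G = 2"
  shows "cyclic_group G" and "lambda_number (power_graph G) = int (order G)"
proof -
  interpret group G by fact
  have "card (carrier G) = 2" using assms(2) by (simp add: order_def)
  then obtain a where car: "carrier G = {\<one>\<^bsub>G\<^esub>, a}" and a1: "a \<noteq> \<one>\<^bsub>G\<^esub>"
    by (smt (verit) card_2_iff doubleton_eq_iff insertE one_closed singletonD)
  have ac: "a \<in> carrier G" by (simp add: car)
  have "a \<otimes>\<^bsub>G\<^esub> a \<noteq> a" using ac a1 by simp
  then have "a \<otimes>\<^bsub>G\<^esub> a = \<one>\<^bsub>G\<^esub>" using ac car m_closed[OF ac ac] by blast
  then have sq: "a [^]\<^bsub>G\<^esub> (2::nat) = \<one>\<^bsub>G\<^esub>"
    using ac by (simp add: numeral_2_eq_2)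
  have "carrier G = range (\<lambda>n::int. a [^]\<^bsub>G\<^esub> n)"
  proof
    show "carrier G \<subseteq> range (\<lambda>n::int. a [^]\<^bsub>G\<^esub> n)"
      using ac by (auto simp: car intro: range_eqI[of _ _ "0::int"] range_eqI[of _ _ "1::int"])
    show "range (\<lambda>n::int. a [^]\<^bsub>G\<^esub> n) \<subseteq> carrier G"
      using ac by auto
  qed
  then show "cyclic_group G" using ac cyclic_group by blast
  let ?\<Gamma> = "power_graph G"
  have arcs: "(\<one>\<^bsub>G\<^esub>, a) \<in> arcs ?\<Gamma>" "(a, \<one>\<^bsub>G\<^esub>) \<in> arcs ?\<Gamma>"
    using sq ac a1 by (auto simp: power_graph_def intro!: exI[of _ "2::nat"])
  have ht: "tail ?\<Gamma> = fst" "head ?\<Gamma> = snd" by (simp_all add: power_graph_def)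
  have d: "graph_dist ?\<Gamma> \<one>\<^bsub>G\<^esub> a = 1" "graph_dist ?\<Gamma> a \<one>\<^bsub>G\<^esub> = 1"
    using graph_dist_adjacent[OF arcs(1)] graph_dist_adjacent[OF arcs(2)] a1 ac
    by (simp_all add: ht)
  have d0: "graph_dist ?\<Gamma> \<one>\<^bsub>G\<^esub> \<one>\<^bsub>G\<^esub> = 0" "graph_dist ?\<Gamma> a a = 0"
    using ac by (auto intro!: graph_dist_self)
  have lab: "L21_labelling ?\<Gamma> f \<longleftrightarrow> \<bar>f \<one>\<^bsub>G\<^esub> - f a\<bar> \<ge> 2" for f
    by (auto simp: L21_labelling_def car d d0 abs_minus_commute)
  have span: "label_span ?\<Gamma> f = \<bar>f \<one>\<^bsub>G\<^esub> - f a\<bar>" for f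
    by (simp add: label_span_def car)
  have "lambda_number ?\<Gamma> = 2"
    unfolding lambda_number_def lab span
  proof (rule Least_equality)
    show "\<exists>f. 2 \<le> \<bar>f \<one>\<^bsub>G\<^esub> - f a\<bar> \<and> (2::int) = \<bar>f \<one>\<^bsub>G\<^esub> - f a\<bar>"
      using a1 by (intro exI[of _ "\<lambda>x. if x = a then 2 else 0"]) auto
  qed auto
  then show "lambda_number ?\<Gamma> = int (order G)" using assms(2) by simp
qed


section \<open>Groups given by generators and relations\<close>

text \<open>
  A word is a list of letters \<open>(g, True)\<close>, standing for the generator \<open>g\<close>, and
  \<open>(g, False)\<close>, standing for its inverse. A pair \<open>(l, r)\<close> in the set \<open>R\<close> is the relation \<open>l = r\<close>.
  The presented group consists of the classes of words modulo free cancellation and \<open>R\<close>.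
\<close>

type_synonym 'g group_word = "('g \<times> bool) list"

inductive word_eq :: "('g group_word \<times> 'g group_word) set \<Rightarrow> 'g group_word \<Rightarrow> 'g group_word \<Rightarrow> bool"
  for R where
  refl: "word_eq R u u"
| sym: "word_eq R u v \<Longrightarrow> word_eq R v u"
| trans: "word_eq R u v \<Longrightarrow> word_eq R v w \<Longrightarrow> word_eq R u w"
| cancel: "word_eq R (u @ [(g, s), (g, \<not> s)] @ v) (u @ v)"
| rel: "(l, r) \<in> R \<Longrightarrow> word_eq R (u @ l @ v) (u @ r @ v)"

definition word_rel :: "('g group_word \<times> 'g group_word) set \<Rightarrow> 'g group_word rel" where
  "word_rel R = {(u, v). word_eq R u v}"

definition presented_group :: "('g group_word \<times> 'g group_word) set \<Rightarrow> 'g group_word set monoid" where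
  "presented_group R =
     \<lparr> carrier = UNIV // word_rel R,
       monoid.mult = (\<lambda>A B. \<Union>u \<in> A. \<Union>v \<in> B. word_rel R `` {u @ v}),
       one = word_rel R `` {[]} \<rparr>"

lemma equiv_word_rel: "equiv UNIV (word_rel R)"
  by (rule equivI)
    (auto simp: word_rel_def refl_on_def sym_def trans_def intro: word_eq.intros)

lemma word_eq_context:
  assumes "word_eq R u v"
  shows "word_eq R (a @ u @ b) (a @ v @ b)"
  using assms
proof induction
  case (cancel u g s v)
  then show ?case using word_eq.cancel[of R "a @ u" g s "v @ b"] by simp
next
  case (rel l r u v)
  then show ?case using word_eq.rel[of l r R "a @ u" "v @ b"] by simp
qed (blast intro: word_eq.intros)+

lemma word_eq_append:
  assumes "word_eq R u u'" "word_eq R v v'"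
  shows "word_eq R (u @ v) (u' @ v')"
  using word_eq_context[OF assms(1), of "[]" v] word_eq_context[OF assms(2), of u' "[]"]
  by (auto intro: word_eq.trans)

lemma mult_presented_group:
  "word_rel R `` {u} \<otimes>\<^bsub>presented_group R\<^esub> word_rel R `` {v} = word_rel R `` {u @ v}"
  unfolding presented_group_def word_rel_def
  by (auto intro: word_eq_append word_eq.intros)

lemma word_eq_inverse:
  "word_eq R (rev (map (\<lambda>(g, s). (g, \<not> s)) u) @ u) []"
proof (induction u)
  case Nil
  then show ?case by (simp add: word_eq.refl)
next
  case (Cons l u)
  obtain g s where l: "l = (g, s)" by fastforce
  show ?case
    using word_eq.cancel[of R "rev (map (\<lambda>(g, s). (g, \<not> s)) u)" g "\<not> s" u] Cons
    by (auto simp: l intro: word_eq.trans)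
qed

lemma group_presented_group: "group (presented_group R)"
proof -
  have car: "A \<in> carrier (presented_group R) \<longleftrightarrow> (\<exists>u. A = word_rel R `` {u})" for A
    by (auto simp: presented_group_def quotient_def)
  have one: "\<one>\<^bsub>presented_group R\<^esub> = word_rel R `` {[]}"
    by (simp add: presented_group_def)
  have cls: "word_eq R u v \<Longrightarrow> word_rel R `` {u} = word_rel R `` {v}" for u v
    using equiv_class_eq[OF equiv_word_rel] by (simp add: word_rel_def)
  show ?thesis
  proof (rule groupI)
    fix A assume "A \<in> carrier (presented_group R)"
    then obtain u where "A = word_rel R `` {u}" by (auto simp: car)
    then show "\<exists>B \<in> carrier (presented_group R). B \<otimes>\<^bsub>presented_group R\<^esub> A = \<one>\<^bsub>presented_group R\<^esub>"
      using cls[OF word_eq_inverse[of R u]] by (metis car mult_presented_group one)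
  qed (auto simp: car one mult_presented_group)
qed


section \<open>Generalized quaternion groups\<close>

datatype quaternion_generator = gen_x | gen_y

definition quaternion_relations ::
    "nat \<Rightarrow> (quaternion_generator group_word \<times> quaternion_generator group_word) set" where
  "quaternion_relations e =
     {(replicate (2 ^ e) (gen_x, True), []),
      (replicate (2 ^ (e - 1)) (gen_x, True), replicate 2 (gen_y, True)),
      ([(gen_y, False), (gen_x, True), (gen_y, True)], [(gen_x, False)])}"

definition generalized_quaternion :: "('a, 'm) monoid_scheme \<Rightarrow> bool" where
  "generalized_quaternion G \<longleftrightarrow>
     (\<exists>e \<ge> 2. G \<cong> presented_group (quaternion_relations e))"

end

theory Submission
  imports Defs "HOL-Algebra.Group_Action" "HOL-Number_Theory.Residues"
begin

text \<open>
  The identity is adjacent to every other vertex of the power graph. An \<open>L(2,1)\<close>-labelling is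
  therefore an injective labelling in which comparable elements receive labels at distance at least
  two, and next to the label of the identity a label is lost. So the lambda number is at least
  \<open>order G\<close>, with equality if the nonidentity elements can be listed so that neighbours in the list
  are incomparable (\<open>lambda_number_power_graph_if_path\<close>). If, on the contrary, some nonidentity
  element is comparable to all others, a second label is lost (\<open>lambda_number_power_graph_gt\<close>). Such
  an element exists in a cyclic group, namely a generator, and in a generalized quaternion group,
  namely its involution (\<open>generalized_quaternion_dominating\<close>).

  For the converse, a finite p-group that is neither cyclic nor generalized quaternion has two
  different subgroups of order \<open>p\<close> (\<open>unique_order_p_subgroup\<close>, \<open>generalized_quaternionI\<close>), and then a
  list as above exists (\<open>incomparable_path\<close>). If for each \<open>p ^ k\<close> up to the exponent there are at least
  two cyclic subgroups of order \<open>p ^ k\<close>, their generators can be visited in turn, order by order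
  (\<open>path_through_levels\<close>). Next to several subgroups of order \<open>p\<close>, a unique cyclic subgroup of order
  \<open>p ^ k\<close> with \<open>k \<ge> 2\<close> occurs only for \<open>p = 2\<close> (\<open>not_commuting_outside_unique_level\<close>), and then
  \<open>G\<close> looks like a dihedral or semidihedral group: the centralizer \<open>H\<close> of an element of order 4 has
  index 2 and one involution, and the list alternates between \<open>H\<close> and its complement
  (\<open>path_if_centralizer_has_one_involution\<close>).

  Both group-theoretic parts rest on one computation: if \<open>x \<otimes> a = a [^] r \<otimes> x\<close> with \<open>r\<close> congruent to
  \<open>1\<close> modulo \<open>p\<close>, and modulo 4 if \<open>p = 2\<close>, then \<open>(a [^] j \<otimes> x) [^] p = a [^] (j * p * s) \<otimes> x [^] p\<close> with
  \<open>s\<close> prime to \<open>p\<close> (\<open>twisted_product_pow\<close>, \<open>power_sum_prime\<close>).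
\<close>

section \<open>Paths through classes of equal size\<close>

lemma successively_concat_replicate:
  assumes "successively P bs" "bs \<noteq> []" "P (last bs) (hd bs)"
  shows "successively P (concat (replicate q bs))"
proof (induction q)
  case (Suc q)
  show ?case
  proof (cases q)
    case 0
    then show ?thesis using assms(1) by simp
  next
    case (Suc r)
    then have "hd (concat (replicate q bs)) = hd bs" using assms(2) by simp
    then show ?thesis
      using Suc.IH assms by (simp add: successively_append_iff)
  qed
qed simp

text \<open>
  Induction on the common size \<open>q\<close>: one representative per fibre forms the first round, and removing
  these representatives leaves fibres of size \<open>q - 1\<close>.
\<close>

lemma enumerate_fibres:
  assumes "finite S" "distinct bs" "set bs = f ` S"
    and "\<And>b. b \<in> f ` S \<Longrightarrow> card {x \<in> S. f x = b} = q"
    and "s \<in> S" "f s = hd bs"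
  shows "\<exists>xs. map f xs = concat (replicate q bs) \<and> distinct xs \<and> set xs = S \<and> hd xs = s"
  using assms
proof (induction q arbitrary: S s)
  case 0
  then have "card {x \<in> S. f x = f s} = 0" by blast
  then show ?case using 0 by auto
next
  case (Suc q)
  define g where "g b = (if b = f s then s else SOME x. x \<in> S \<and> f x = b)" for b
  have g: "g b \<in> S \<and> f (g b) = b" if "b \<in> set bs" for b
  proof (cases "b = f s")
    case False
    obtain x where "x \<in> S \<and> f x = b" using \<open>b \<in> set bs\<close> Suc.prems(3) by auto
    then show ?thesis using False someI[of "\<lambda>x. x \<in> S \<and> f x = b" x] by (simp add: g_def)
  qed (use Suc.prems in \<open>auto simp: g_def\<close>)
  have ne: "bs \<noteq> []" using Suc.prems by auto
  define S' where "S' = S - g ` set bs"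
  have fibre: "{x \<in> S'. f x = b} = {x \<in> S. f x = b} - {g b}" if "b \<in> set bs" for b
    using g that by (auto simp: S'_def)
  have card: "card {x \<in> S'. f x = b} = q" if "b \<in> set bs" for b
    unfolding fibre[OF that] using g[OF that] Suc.prems(1,3) Suc.prems(4)[of b] that by simp
  have hd: "hd (map g bs) = s" using ne Suc.prems(6) by (simp add: hd_map g_def)
  have mapg: "map f (map g bs) = bs" using g by (simp add: map_idI)
  then have dist: "distinct (map g bs)" by (metis Suc.prems(2) distinct_map)
  show ?case
  proof (cases "q = 0")
    case True
    have "S' = {}"
    proof (rule ccontr)
      assume "S' \<noteq> {}"
      then obtain x where x: "x \<in> S'" by auto
      then have "f x \<in> set bs" using Suc.prems(3) by (auto simp: S'_def)
      from card[OF this] x True Suc.prems(1) show False by (auto simp: S'_def)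
    qed
    then have "set (map g bs) = S" using g by (auto simp: S'_def)
    then show ?thesis using True mapg dist hd by (intro exI[of _ "map g bs"]) simp
  next
    case False
    have im: "f ` S' = set bs"
    proof
      show "f ` S' \<subseteq> set bs" using Suc.prems(3) by (auto simp: S'_def)
      show "set bs \<subseteq> f ` S'"
      proof
        fix b assume "b \<in> set bs"
        then have "{x \<in> S'. f x = b} \<noteq> {}" using card[of b] False by (metis card.empty)
        then show "b \<in> f ` S'" by auto
      qed
    qed
    have "hd bs \<in> f ` S'" using im ne by simp
    then obtain s' where s': "s' \<in> S'" "f s' = hd bs" by auto
    have "\<exists>xs. map f xs = concat (replicate q bs) \<and> distinct xs \<and> set xs = S' \<and> hd xs = s'"
      using Suc.prems im card s' by (intro Suc.IH) (auto simp: S'_def)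
    then obtain xs where xs: "map f xs = concat (replicate q bs)" "distinct xs" "set xs = S'"
      by blast
    have "map f (map g bs @ xs) = concat (replicate (Suc q) bs)"
      using mapg xs(1) by simp
    moreover have "distinct (map g bs @ xs)" using dist xs by (auto simp: S'_def)
    moreover have "set (map g bs @ xs) = S" using g xs by (auto simp: S'_def)
    moreover have "hd (map g bs @ xs) = s" using hd ne by simp
    ultimately show ?thesis by blast
  qed
qed

text \<open>
  Running through the classes cyclically, one element of each at a time, exhausts classes of equal
  size simultaneously; with at least two classes no two neighbours share a class.
\<close>

lemma round_robin:
  assumes "finite S" "s \<in> S" "\<exists>t \<in> S. f t \<noteq> f s"
    and "\<And>x y. x \<in> S \<Longrightarrow> y \<in> S \<Longrightarrow> card {u \<in> S. f u = f x} = card {u \<in> S. f u = f y}"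
  shows "\<exists>xs. distinct xs \<and> set xs = S \<and> hd xs = s \<and> successively (\<lambda>x y. f x \<noteq> f y) xs"
proof -
  obtain cs where cs: "distinct cs" "set cs = f ` S - {f s}"
    using assms(1) finite_distinct_list[of "f ` S - {f s}"] by auto
  define bs where "bs = f s # cs"
  have ne: "cs \<noteq> []" using cs assms(3) by auto
  have bs: "distinct bs" "set bs = f ` S" "hd bs = f s" using cs assms(2) by (auto simp: bs_def)
  have "successively (\<noteq>) bs"
    using bs(1) by (induction bs) (auto simp: successively_Cons)
  moreover have "last bs \<noteq> hd bs"
    using ne cs last_in_set[of cs] by (auto simp: bs_def)
  ultimately have succ: "successively (\<noteq>) (concat (replicate q bs))" for q
    by (intro successively_concat_replicate) (auto simp: bs_def)
  have "\<exists>xs. map f xs = concat (replicate (card {u \<in> S. f u = f s}) bs) \<and>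
      distinct xs \<and> set xs = S \<and> hd xs = s"
  proof (rule enumerate_fibres[OF assms(1) bs(1,2)])
    fix b assume "b \<in> f ` S"
    then obtain x where "x \<in> S" "b = f x" by blast
    then show "card {u \<in> S. f u = b} = card {u \<in> S. f u = f s}" using assms(2,4) by blast
  qed (use assms(2) bs(3) in auto)
  then obtain xs where xs: "map f xs = concat (replicate (card {u \<in> S. f u = f s}) bs)"
      "distinct xs" "set xs = S" "hd xs = s" by blast
  have "successively (\<noteq>) (map f xs)" unfolding xs(1) by (rule succ)
  then have "successively (\<lambda>x y. f x \<noteq> f y) xs" by (simp only: successively_map)
  then show ?thesis using xs by blast
qed

lemma alternate:
  assumes "length xs = length ys" "\<And>x y. x \<in> set xs \<Longrightarrow> y \<in> set ys \<Longrightarrow> R x y \<and> R y x"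
    and "distinct xs" "distinct ys" "set xs \<inter> set ys = {}"
  shows "\<exists>zs. distinct zs \<and> set zs = set xs \<union> set ys \<and> successively R zs \<and> (xs \<noteq> [] \<longrightarrow> hd zs = hd xs)"
  using assms
proof (induction xs ys rule: list_induct2)
  case (Cons x xs y ys)
  obtain zs where zs: "distinct zs" "set zs = set xs \<union> set ys" "successively R zs"
     "xs \<noteq> [] \<longrightarrow> hd zs = hd xs" using Cons by (auto simp: Int_Un_distrib)
  have "zs = [] \<or> hd zs = hd xs \<and> xs \<noteq> []" using zs(2,4) Cons.hyps by auto
  then have "zs = [] \<or> hd zs \<in> set xs" by auto
  then have "successively R (x # y # zs)" using zs(3) Cons.prems by (auto simp: successively_Cons)
  moreover have "distinct (x # y # zs)" using zs Cons.prems by auto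
  ultimately show ?case using zs(2) by (intro exI[of _ "x # y # zs"]) auto
qed auto

section \<open>Gaps in sets of integers\<close>

text \<open>
  A second element lies on one side of \<open>k\<close>, and the missing neighbour of \<open>k\<close> on that side is a gap
  inside the range.
\<close>

lemma span_isolated:
  fixes F :: "int set"
  assumes "finite F" "card F \<ge> 2" "k \<in> F" "k + 1 \<notin> F" "k - 1 \<notin> F"
  shows "int (card F) \<le> Max F - Min F"
proof -
  have "\<exists>j \<in> F. j \<noteq> k"
  proof (rule ccontr)
    assume "\<not> ?thesis"
    then have "F \<subseteq> {k}" by auto
    then have "card F \<le> 1" using card_mono[of "{k}" F] by simp
    then show False using assms(2) by simp
  qed
  then obtain j where j: "j \<in> F" "j \<noteq> k" by blast
  have b: "Min F \<le> i \<and> i \<le> Max F" if "i \<in> F" for i using assms(1) that by simp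
  obtain g where g: "g \<notin> F" "Min F \<le> g" "g \<le> Max F"
  proof (cases "j < k")
    case True
    then show ?thesis using that[of "k - 1"] b[OF j(1)] b[OF assms(3)] assms(5) by linarith
  next
    case False
    then show ?thesis using that[of "k + 1"] b[OF j(1)] b[OF assms(3)] assms(4) j by linarith
  qed
  have "F \<union> {g} \<subseteq> {Min F..Max F}" using b g by auto
  then have "card (F \<union> {g}) \<le> card {Min F..Max F}" by (intro card_mono) auto
  then have "Suc (card F) \<le> nat (Max F - Min F + 1)" using assms(1) g(1) by simp
  then show ?thesis using assms(2) by linarith
qed

text \<open>
  For \<open>k < l\<close> the gaps \<open>k + 1\<close> and \<open>l - 1\<close> coincide if \<open>l = k + 2\<close>. The position of a third element
  therefore decides which two gaps lie inside the range.
\<close>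

lemma span_two_isolated:
  fixes F :: "int set"
  assumes fin: "finite F" and "card F \<ge> 3" "k \<in> F" "l \<in> F" "k \<noteq> l"
    and iso: "k + 1 \<notin> F" "k - 1 \<notin> F" "l + 1 \<notin> F" "l - 1 \<notin> F"
  shows "int (card F) < Max F - Min F"
proof -
  have *: "int (card F) < Max F - Min F" if kl: "k \<in> F" "l \<in> F" "k < l"
    "k + 1 \<notin> F" "k - 1 \<notin> F" "l + 1 \<notin> F" "l - 1 \<notin> F" for k l
  proof -
    have b: "Min F \<le> i \<and> i \<le> Max F" if "i \<in> F" for i using fin that by simp
    have "\<exists>j \<in> F. j \<noteq> k \<and> j \<noteq> l"
    proof (rule ccontr)
      assume "\<not> ?thesis"
      then have "F \<subseteq> {k, l}" by auto
      then have "card F \<le> card {k, l}" using card_mono[of "{k, l}" F] by simp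
      also have "\<dots> \<le> 2" by (simp add: card_insert_if)
      finally show False using assms(2) by simp
    qed
    then obtain j where j: "j \<in> F" "j \<noteq> k" "j \<noteq> l" by blast
    note bs = b[OF kl(1)] b[OF kl(2)] b[OF j(1)]
    have "\<exists>g h. g \<notin> F \<and> h \<notin> F \<and> g < h \<and> Min F \<le> g \<and> h \<le> Max F"
    proof -
      have l: "l \<noteq> k + 1" using kl by auto
      have "j < k \<or> (k < j \<and> j < l) \<or> l < j" using j by linarith
      moreover have "j \<noteq> k + 1" using kl j by auto
      ultimately consider "j < k" | "k + 2 \<le> j" "j < l" | "l < j" by linarith
      then show ?thesis
      proof cases
        case 1
        then show ?thesis using bs kl l
          by (intro exI[of _ "k - 1"] exI[of _ "k + 1"]) linarith
      next
        case 2
        have "j \<noteq> l - 1" using kl j by auto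
        then show ?thesis using 2 bs kl l
          by (intro exI[of _ "k + 1"] exI[of _ "l - 1"]) linarith
      next
        case 3
        then show ?thesis using bs kl l
          by (intro exI[of _ "l - 1"] exI[of _ "l + 1"]) linarith
      qed
    qed
    then obtain g h where gh: "g \<notin> F" "h \<notin> F" "g < h" "Min F \<le> g" "h \<le> Max F" by blast
    have "F \<union> {g, h} \<subseteq> {Min F..Max F}" using b gh by auto
    then have "card (F \<union> {g, h}) \<le> card {Min F..Max F}" by (intro card_mono) auto
    moreover have "card (F \<union> {g, h}) = card F + 2" using gh fin by simp
    ultimately have "card F + 2 \<le> nat (Max F - Min F + 1)" by simp
    then show ?thesis using assms(2) by linarith
  qed
  show ?thesis
  proof (cases "k < l")
    case True
    then show ?thesis using * assms by blast
  next
    case False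
    then show ?thesis using *[of l k] assms by simp
  qed
qed

section \<open>Labellings of power graphs\<close>

lemma arc_if_graph_dist_1:
  assumes "graph_dist \<Gamma> a b = 1"
  shows "\<exists>e \<in> arcs \<Gamma>. tail \<Gamma> e = a \<and> head \<Gamma> e = b"
proof -
  let ?P = "{p. pre_digraph.apath \<Gamma> a p b}"
  let ?L = "(\<lambda>p. enat (length p)) ` ?P"
  have "?L \<noteq> {}"
  proof
    assume "?L = {}"
    then have "graph_dist \<Gamma> a b = \<infinity>" by (simp only: graph_dist_def Inf_enat_def) simp
    then show False using assms by simp
  qed
  then have "Inf ?L \<in> ?L" unfolding Inf_enat_def by (auto intro: LeastI)
  then have "graph_dist \<Gamma> a b \<in> ?L" by (simp only: graph_dist_def)
  then obtain p where p: "pre_digraph.apath \<Gamma> a p b" "enat (length p) = 1"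
    using assms by auto
  then obtain e where "p = [e]" by (auto simp: one_enat_def length_Suc_conv)
  then show ?thesis
    using p(1) by (auto simp: pre_digraph.apath_def pre_digraph.awalk_def pre_digraph.cas.simps)
qed

lemma graph_dist_ge_1:
  assumes "a \<noteq> b"
  shows "1 \<le> graph_dist \<Gamma> a b"
proof -
  have "1 \<le> enat (length p)" if "pre_digraph.apath \<Gamma> a p b" for p
    using that assms by (cases p) (auto simp: pre_digraph.apath_def pre_digraph.awalk_def
        pre_digraph.cas.simps one_enat_def)
  then show ?thesis unfolding graph_dist_def by (intro INF_greatest) simp
qed

lemma graph_dist_le_2:
  assumes "e \<in> arcs \<Gamma>" "tail \<Gamma> e = a" "head \<Gamma> e = c"
    and "e' \<in> arcs \<Gamma>" "tail \<Gamma> e' = c" "head \<Gamma> e' = b"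
    and "a \<in> verts \<Gamma>" "a \<noteq> b" "a \<noteq> c" "c \<noteq> b"
  shows "graph_dist \<Gamma> a b \<le> 2"
proof -
  have "pre_digraph.apath \<Gamma> a [e, e'] b"
    using assms by (simp add: pre_digraph.apath_def pre_digraph.awalk_def
        pre_digraph.cas.simps pre_digraph.awalk_verts.simps)
  then have "graph_dist \<Gamma> a b \<le> enat (length [e, e'])"
    unfolding graph_dist_def by (intro INF_lower) simp
  then show ?thesis by (simp add: numeral_eq_enat numeral_2_eq_2)
qed

text \<open>
  For distinct elements of a finite group this is adjacency in the power graph. The exponent \<open>0\<close> is
  admitted because the identity then is comparable to everything by definition.
\<close>

definition comparable :: "('a, 'm) monoid_scheme \<Rightarrow> 'a \<Rightarrow> 'a \<Rightarrow> bool" where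
  "comparable G x y \<longleftrightarrow> (\<exists>n::nat. x = y [^]\<^bsub>G\<^esub> n) \<or> (\<exists>n::nat. y = x [^]\<^bsub>G\<^esub> n)"

lemma comparable_sym: "comparable G x y \<longleftrightarrow> comparable G y x"
  by (auto simp: comparable_def)

context group
begin

lemma arcs_power_graph:
  assumes "finite (carrier G)"
  shows "(a, b) \<in> arcs (power_graph G) \<longleftrightarrow>
    a \<in> carrier G \<and> b \<in> carrier G \<and> a \<noteq> b \<and> comparable G a b"
proof -
  \<comment> \<open>Finite order turns the exponent \<open>0\<close> into a positive one.\<close>
  have pos: "(\<exists>n::nat. n > 0 \<and> x = y [^] n) \<longleftrightarrow> (\<exists>n::nat. x = y [^] n)" if "y \<in> carrier G" for x y
  proof
    assume "\<exists>n::nat. x = y [^] n"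
    then obtain n :: nat where "x = y [^] n" by blast
    moreover have "y [^] (n + ord y) = y [^] n"
      using that by (simp add: nat_pow_mult[symmetric] pow_ord_eq_1[OF that])
    ultimately show "\<exists>n::nat. n > 0 \<and> x = y [^] n"
      using ord_ge_1[OF assms that] by (intro exI[of _ "n + ord y"]) auto
  qed blast
  show ?thesis by (auto simp: power_graph_def comparable_def pos)
qed

text \<open>
  The identity is adjacent to all other elements, so two distinct elements have distance one or two
  and the condition at distance two amounts to injectivity.
\<close>

lemma L21_labelling_power_graph:
  assumes "finite (carrier G)"
  shows "L21_labelling (power_graph G) f \<longleftrightarrow> inj_on f (carrier G) \<and>
    (\<forall>a \<in> carrier G. \<forall>b \<in> carrier G. a \<noteq> b \<and> comparable G a b \<longrightarrow> \<bar>f a - f b\<bar> \<ge> 2)"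
    (is "_ \<longleftrightarrow> ?R")
proof -
  let ?\<Gamma> = "power_graph G"
  have ht: "tail ?\<Gamma> = fst" "head ?\<Gamma> = snd" by (simp_all add: power_graph_def)
  have d1: "graph_dist ?\<Gamma> a b = 1 \<longleftrightarrow> comparable G a b"
    if "a \<in> carrier G" "b \<in> carrier G" "a \<noteq> b" for a b
  proof
    assume "graph_dist ?\<Gamma> a b = 1"
    then have "(a, b) \<in> arcs ?\<Gamma>" using arc_if_graph_dist_1[of ?\<Gamma> a b] ht by auto
    then show "comparable G a b" using arcs_power_graph[OF assms] by simp
  next
    assume "comparable G a b"
    then have "(a, b) \<in> arcs ?\<Gamma>" using arcs_power_graph[OF assms] that by simp
    then show "graph_dist ?\<Gamma> a b = 1" using graph_dist_adjacent[of "(a, b)" ?\<Gamma>] that ht by simp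
  qed
  have d2: "graph_dist ?\<Gamma> a b = 2"
    if "a \<in> carrier G" "b \<in> carrier G" "a \<noteq> b" "\<not> comparable G a b" for a b
  proof -
    have one: "comparable G \<one> x" for x by (auto simp: comparable_def intro: exI[of _ "0::nat"])
    have ne: "a \<noteq> \<one>" "b \<noteq> \<one>" using one that(4) comparable_sym[of G a b] by auto
    then have "(a, \<one>) \<in> arcs ?\<Gamma>" "(\<one>, b) \<in> arcs ?\<Gamma>"
      using arcs_power_graph[OF assms] that one comparable_sym[of G] by auto
    then have "graph_dist ?\<Gamma> a b \<le> 2"
      using graph_dist_le_2[of "(a, \<one>)" ?\<Gamma> a \<one> "(\<one>, b)" b] that ne ht by auto
    moreover have "graph_dist ?\<Gamma> a b \<noteq> 1" using d1 that by blast
    moreover have "1 \<le> graph_dist ?\<Gamma> a b" using graph_dist_ge_1 that by metis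
    ultimately show ?thesis
      by (cases "graph_dist ?\<Gamma> a b") (auto simp: one_enat_def numeral_eq_enat)
  qed
  have d0: "graph_dist ?\<Gamma> a a = 0" if "a \<in> carrier G" for a
    using graph_dist_self[of a ?\<Gamma>] that by simp
  show ?thesis
  proof
    assume L: "L21_labelling ?\<Gamma> f"
    have sep: "(comparable G a b \<longrightarrow> \<bar>f a - f b\<bar> \<ge> 2) \<and> \<bar>f a - f b\<bar> \<ge> 1"
      if "a \<in> carrier G" "b \<in> carrier G" "a \<noteq> b" for a b
    proof (cases "comparable G a b")
      case True
      then have "\<bar>f a - f b\<bar> \<ge> 2" using L d1[OF that] that by (auto simp: L21_labelling_def)
      then show ?thesis by linarith
    next
      case False
      then show ?thesis using L d2[OF that] that by (auto simp: L21_labelling_def)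
    qed
    have "inj_on f (carrier G)"
    proof (rule inj_onI, rule ccontr)
      fix a b assume "a \<in> carrier G" "b \<in> carrier G" "f a = f b" "a \<noteq> b"
      then show False using sep[of a b] by simp
    qed
    then show ?R using sep by blast
  next
    assume R: ?R
    show "L21_labelling ?\<Gamma> f"
      unfolding L21_labelling_def
    proof (intro ballI)
      fix a b assume "a \<in> verts ?\<Gamma>" "b \<in> verts ?\<Gamma>"
      then have ab: "a \<in> carrier G" "b \<in> carrier G" by simp_all
      show "(graph_dist ?\<Gamma> a b = 1 \<longrightarrow> \<bar>f a - f b\<bar> \<ge> 2) \<and> (graph_dist ?\<Gamma> a b = 2 \<longrightarrow> \<bar>f a - f b\<bar> \<ge> 1)"
      proof (cases "a = b")
        case False
        then have "f a \<noteq> f b" using R ab by (auto dest: inj_onD)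
        then have "\<bar>f a - f b\<bar> \<ge> 1" by linarith
        then show ?thesis using R ab False d1[OF ab False] by auto
      qed (use ab d0 in auto)
    qed
  qed
qed

lemma dominating_label_isolated:
  assumes "finite (carrier G)" "L21_labelling (power_graph G) f"
    and "z \<in> carrier G" "\<And>g. g \<in> carrier G \<Longrightarrow> comparable G z g"
  shows "f z + 1 \<notin> f ` carrier G" "f z - 1 \<notin> f ` carrier G"
proof -
  have "\<bar>f z - f g\<bar> \<noteq> 1" if "g \<in> carrier G" for g
    using assms that L21_labelling_power_graph[OF assms(1), of f] by (cases "z = g") force+
  then show "f z + 1 \<notin> f ` carrier G" "f z - 1 \<notin> f ` carrier G" by force+
qed

lemma lambda_number_power_graph_ge:
  assumes "finite (carrier G)" "order G \<ge> 2"
  shows "int (order G) \<le> lambda_number (power_graph G)"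
proof -
  obtain f where f: "L21_labelling (power_graph G) f"
      "lambda_number (power_graph G) = label_span (power_graph G) f"
    using lambda_number_attained[of "power_graph G"] assms by auto
  have "card (f ` carrier G) = order G"
    using f(1) L21_labelling_power_graph[OF assms(1)] by (simp add: card_image order_def)
  moreover have "comparable G \<one> g" for g by (auto simp: comparable_def intro: exI[of _ "0::nat"])
  ultimately show ?thesis
    using span_isolated[of "f ` carrier G" "f \<one>"] dominating_label_isolated[OF assms(1) f(1), of \<one>] assms
    by (simp add: f(2) label_span_def)
qed

lemma lambda_number_power_graph_gt:
  assumes "finite (carrier G)" "order G \<ge> 3"
    and "z \<in> carrier G" "z \<noteq> \<one>" "\<And>g. g \<in> carrier G \<Longrightarrow> g \<noteq> \<one> \<Longrightarrow> comparable G z g"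
  shows "int (order G) < lambda_number (power_graph G)"
proof -
  obtain f where f: "L21_labelling (power_graph G) f"
      "lambda_number (power_graph G) = label_span (power_graph G) f"
    using lambda_number_attained[of "power_graph G"] assms by auto
  have inj: "inj_on f (carrier G)" using f(1) L21_labelling_power_graph[OF assms(1)] by simp
  then have card: "card (f ` carrier G) = order G" by (simp add: card_image order_def)
  have one: "comparable G \<one> g" "comparable G g \<one>" for g
    by (auto simp: comparable_def intro: exI[of _ "0::nat"])
  then have z: "comparable G z g" if "g \<in> carrier G" for g using assms(5) that by metis
  have "f z \<noteq> f \<one>" using inj assms(3,4) by (auto dest: inj_onD)
  then show ?thesis
    using span_two_isolated[of "f ` carrier G" "f \<one>" "f z"] assms(1,2,3) card
      dominating_label_isolated[OF assms(1) f(1), of \<one>] one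
      dominating_label_isolated[OF assms(1) f(1), of z] z
    by (simp add: f(2) label_span_def)
qed

text \<open>
  Along a list of the nonidentity elements whose neighbours are incomparable, consecutive labels are
  admissible; the identity receives a label at distance two from the first of them.
\<close>

lemma lambda_number_power_graph_if_path:
  assumes fin: "finite (carrier G)" and "order G \<ge> 2"
    and xs: "distinct xs" "set xs = carrier G - {\<one>}" "successively (\<lambda>x y. \<not> comparable G x y) xs"
  shows "lambda_number (power_graph G) = int (order G)"
proof -
  have len: "Suc (length xs) = order G"
    using xs(1,2) fin assms(2) distinct_card[OF xs(1)] by (simp add: order_def)
  define idx where "idx x = (THE i. i < length xs \<and> xs ! i = x)" for x
  have idx_nth: "idx (xs ! i) = i" if "i < length xs" for i
    unfolding idx_def using that xs(1) by (auto simp: nth_eq_iff_index_eq intro!: the_equality)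
  have idx: "idx x < length xs \<and> xs ! idx x = x" if "x \<in> carrier G" "x \<noteq> \<one>" for x
  proof -
    have "x \<in> set xs" using that xs(2) by simp
    then obtain i where "i < length xs" "xs ! i = x" by (auto simp: in_set_conv_nth)
    then show ?thesis using idx_nth by auto
  qed
  define f where "f x = (if x = \<one> then 0 else int (idx x) + 2)" for x
  have step: "\<not> comparable G (xs ! i) (xs ! Suc i)" if "Suc i < length xs" for i
    using successively_nth[OF xs(3)] that by blast
  have inj: "inj_on f (carrier G)"
  proof (rule inj_onI)
    fix x y assume "x \<in> carrier G" "y \<in> carrier G" "f x = f y"
    then have "x = \<one> \<and> y = \<one> \<or> x \<noteq> \<one> \<and> y \<noteq> \<one> \<and> idx x = idx y" by (auto simp: f_def split: if_splits)
    then show "x = y" using idx \<open>x \<in> carrier G\<close> \<open>y \<in> carrier G\<close> by metis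
  qed
  have "\<bar>f a - f b\<bar> \<ge> 2" if ab: "a \<in> carrier G" "b \<in> carrier G" "a \<noteq> b" "comparable G a b" for a b
  proof (cases "a = \<one> \<or> b = \<one>")
    case False
    then have i: "idx a < length xs" "xs ! idx a = a" "idx b < length xs" "xs ! idx b = b"
      using idx ab by auto
    have "idx a \<noteq> idx b" using i ab(3) by metis
    moreover have "idx b \<noteq> Suc (idx a)" using step[of "idx a"] i ab(4) by metis
    moreover have "idx a \<noteq> Suc (idx b)" using step[of "idx b"] i ab(4) comparable_sym by metis
    ultimately show ?thesis using False by (auto simp: f_def)
  qed (use ab in \<open>auto simp: f_def\<close>)
  then have L: "L21_labelling (power_graph G) f"
    using inj L21_labelling_power_graph[OF fin] by blast
  have "0 \<le> f x \<and> f x \<le> int (order G)" if "x \<in> carrier G" for x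
    using idx[OF that] len by (auto simp: f_def)
  moreover have ne: "f ` carrier G \<noteq> {}" by auto
  ultimately have "0 \<le> Min (f ` carrier G)" "Max (f ` carrier G) \<le> int (order G)"
    using fin by auto
  then have "label_span (power_graph G) f \<le> int (order G)" by (simp add: label_span_def)
  moreover have "lambda_number (power_graph G) \<le> label_span (power_graph G) f"
    using lambda_number_attained[of "power_graph G"] fin ne L by auto
  ultimately show ?thesis using lambda_number_power_graph_ge[OF assms(1,2)] by linarith
qed

end

section \<open>Twisted power sums\<close>

text \<open>
  Modulo \<open>p\<^sup>2\<close>, \<open>r ^ i\<close> is \<open>1 + i * (r - 1)\<close>, so the sum is \<open>p + (r - 1) * (p * (p - 1) / 2)\<close>. For odd
  \<open>p\<close> the second summand is divisible by \<open>p\<^sup>2\<close>; for \<open>p = 2\<close> it is \<open>r - 1\<close>, whence the stronger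
  hypothesis.
\<close>

lemma power_sum_prime:
  fixes p r :: nat
  assumes p: "prime p" and r: "[r = 1] (mod p)" and four: "p = 2 \<Longrightarrow> [r = 1] (mod 4)"
  shows "\<exists>s. (\<Sum>i<p. r ^ i) = p * s \<and> \<not> p dvd s"
proof -
  have p2: "p \<ge> 2" using p by (rule prime_ge_2_nat)
  have "[(\<Sum>i<p. r ^ i) = p] (mod p\<^sup>2)"
  proof (cases "p = 2")
    case True
    have "(\<Sum>i<2. r ^ i) = 1 + r" by (simp add: numeral_2_eq_2)
    moreover have "[1 + r = 2] (mod 4)" using cong_add[of 1 1 4 r 1] four True
      by (simp add: numeral_2_eq_2)
    moreover have "p\<^sup>2 = 4" using True by simp
    ultimately show ?thesis using True by simp
  next
    case False
    define t where "t = r div p"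
    have rt: "r = 1 + p * t"
      using r p2 mult_div_mod_eq[of p r] by (simp add: cong_def t_def)
    have pow: "[r ^ i = 1 + i * (p * t)] (mod p\<^sup>2)" for i
    proof (induction i)
      case (Suc i)
      have "[r ^ Suc i = (1 + p * t) * (1 + i * (p * t))] (mod p\<^sup>2)"
        unfolding power_Suc by (intro cong_mult Suc.IH) (simp add: rt)
      also have "(1 + p * t) * (1 + i * (p * t)) = 1 + Suc i * (p * t) + p\<^sup>2 * (i * t\<^sup>2)"
        by (simp add: algebra_simps power2_eq_square)
      also have "[1 + Suc i * (p * t) + p\<^sup>2 * (i * t\<^sup>2) = 1 + Suc i * (p * t)] (mod p\<^sup>2)"
        by (simp add: cong_def)
      finally show ?case .
    qed simp
    have "[(\<Sum>i<p. r ^ i) = (\<Sum>i<p. 1 + i * (p * t))] (mod p\<^sup>2)"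
      by (intro cong_sum pow)
    also have "(\<Sum>i<p. 1 + i * (p * t)) = p + (\<Sum>i<p. i) * (p * t)"
      by (simp only: sum.distrib sum_distrib_right) simp
    also have "(\<Sum>i<p. i) = p * ((p - 1) div 2)"
    proof -
      have "odd p" using p False prime_odd_nat p2 by (metis le_neq_implies_less)
      then obtain m where m: "p = 2 * m + 1" by (elim oddE)
      have "(\<Sum>i<k. i) * 2 = k * (k - 1)" for k :: nat by (induction k) (auto simp: algebra_simps)
      from this[of p] show ?thesis using m by simp
    qed
    also have "[p + p * ((p - 1) div 2) * (p * t) = p] (mod p\<^sup>2)"
    proof -
      have "p + p * ((p - 1) div 2) * (p * t) = p + p\<^sup>2 * ((p - 1) div 2 * t)"
        by (simp add: power2_eq_square algebra_simps)
      then show ?thesis by (simp only: cong_def mod_mult_self2)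
    qed
    finally show ?thesis .
  qed
  moreover have "p < p\<^sup>2" using p2 by (simp add: power2_eq_square)
  ultimately have "(\<Sum>i<p. r ^ i) mod p\<^sup>2 = p" by (simp add: cong_def)
  moreover define q where "q = (\<Sum>i<p. r ^ i) div p\<^sup>2"
  ultimately have "(\<Sum>i<p. r ^ i) = p\<^sup>2 * q + p"
    using mult_div_mod_eq[of "p\<^sup>2" "\<Sum>i<p. r ^ i"] by simp
  then have "(\<Sum>i<p. r ^ i) = p * (p * q + 1)"
    by (simp add: power2_eq_square algebra_simps)
  moreover have "\<not> p dvd p * q + 1"
    using p2 dvd_add_right_iff[of p "p * q" 1] by simp
  ultimately show ?thesis by blast
qed

context group
begin

lemma twisted_pow:
  assumes "a \<in> carrier G" "x \<in> carrier G" "x \<otimes> a = a [^] (r::nat) \<otimes> x"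
  shows "x [^] (n::nat) \<otimes> a [^] (j::nat) = a [^] (j * r ^ n) \<otimes> x [^] n"
proof -
  have one: "x \<otimes> a [^] j = a [^] (j * r) \<otimes> x" for j :: nat
  proof (induction j)
    case (Suc j)
    have "x \<otimes> a [^] Suc j = (x \<otimes> a [^] j) \<otimes> a" using assms by (simp add: m_assoc)
    also have "\<dots> = a [^] (j * r) \<otimes> (x \<otimes> a)"
      unfolding Suc using assms(1,2) by (simp add: m_assoc)
    also have "\<dots> = a [^] (j * r) \<otimes> (a [^] r \<otimes> x)" unfolding assms(3) ..
    also have "\<dots> = a [^] (Suc j * r) \<otimes> x"
      using assms(1,2) by (simp add: m_assoc[symmetric] nat_pow_mult add.commute)
    finally show ?case .
  qed (use assms in simp)
  show ?thesis
  proof (induction n arbitrary: j)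
    case (Suc n)
    have "x [^] Suc n \<otimes> a [^] j = x [^] n \<otimes> (x \<otimes> a [^] j)"
      using assms(1,2) by (simp add: m_assoc)
    also have "\<dots> = (x [^] n \<otimes> a [^] (j * r)) \<otimes> x"
      unfolding one using assms(1,2) by (simp add: m_assoc)
    also have "\<dots> = a [^] (j * r ^ Suc n) \<otimes> x [^] Suc n"
      unfolding Suc using assms(1,2) by (simp add: m_assoc mult.assoc)
    finally show ?case .
  qed (use assms in simp)
qed

lemma twisted_product_pow:
  assumes "a \<in> carrier G" "x \<in> carrier G" "x \<otimes> a = a [^] (r::nat) \<otimes> x"
  shows "(a [^] (j::nat) \<otimes> x) [^] (n::nat) = a [^] (j * (\<Sum>i<n. r ^ i)) \<otimes> x [^] n"
proof (induction n)
  case (Suc n)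
  have "(a [^] j \<otimes> x) [^] Suc n = a [^] (j * (\<Sum>i<n. r ^ i)) \<otimes> (x [^] n \<otimes> a [^] j) \<otimes> x"
    using assms(1,2) Suc by (simp add: m_assoc)
  also have "\<dots> = a [^] (j * (\<Sum>i<n. r ^ i)) \<otimes> a [^] (j * r ^ n) \<otimes> x [^] Suc n"
    unfolding twisted_pow[OF assms] using assms(1,2) by (simp add: m_assoc)
  also have "\<dots> = a [^] (j * (\<Sum>i<Suc n. r ^ i)) \<otimes> x [^] Suc n"
    using assms(1,2) by (simp add: nat_pow_mult distrib_left)
  finally show ?case .
qed (use assms in simp)

lemma conjugate_pow:
  assumes "g \<in> carrier G" "x \<in> carrier G"
  shows "g \<otimes> x [^] (n::nat) \<otimes> inv g = (g \<otimes> x \<otimes> inv g) [^] n"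
proof (induction n)
  case (Suc n)
  have "(g \<otimes> x \<otimes> inv g) [^] Suc n = (g \<otimes> x [^] n \<otimes> inv g) \<otimes> (g \<otimes> x \<otimes> inv g)"
    by (simp add: Suc)
  also have "\<dots> = g \<otimes> x [^] n \<otimes> (inv g \<otimes> g) \<otimes> x \<otimes> inv g"
    using assms by (simp only: m_assoc m_closed inv_closed nat_pow_closed)
  also have "\<dots> = g \<otimes> x [^] Suc n \<otimes> inv g"
    using assms by (simp add: m_assoc)
  finally show ?case by simp
qed (use assms in simp)

lemma pow_eq_iff_cong:
  assumes "a \<in> carrier G"
  shows "a [^] (i::nat) = a [^] (j::nat) \<longleftrightarrow> [i = j] (mod ord a)"
proof -
  have "a [^] i = a [^] j \<longleftrightarrow> a [^] int i = a [^] int j" by (simp add: int_pow_int)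
  also have "\<dots> \<longleftrightarrow> int (ord a) dvd int j - int i" using int_pow_eq[OF assms] by blast
  also have "\<dots> \<longleftrightarrow> [int j = int i] (mod int (ord a))" by (simp add: cong_iff_dvd_diff)
  also have "\<dots> \<longleftrightarrow> [i = j] (mod ord a)" by (simp add: cong_int_iff cong_sym_eq)
  finally show ?thesis .
qed

lemma generate_singleton_mono:
  assumes "u \<in> carrier G" "v \<in> generate G {u}"
  shows "generate G {v} \<subseteq> generate G {u}"
  using assms generate_subgroup_incl[of "{v}" "generate G {u}"] generate_is_subgroup[of "{u}"] by auto

end

section \<open>Finite p-groups\<close>

locale p_group = group +
  fixes p n :: nat
  assumes prime: "prime p" and fin: "finite (carrier G)" and order_eq: "order G = p ^ n"
begin

lemma p_ge_2: "p \<ge> 2"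
  using prime by (rule prime_ge_2_nat)

lemma ord_pos: "x \<in> carrier G \<Longrightarrow> 0 < ord x"
  using ord_ge_1[OF fin, of x] by simp

lemma ord_prime_power:
  assumes "x \<in> carrier G"
  obtains k where "ord x = p ^ k"
  using ord_dvd_group_order[OF assms] prime by (auto simp: order_eq divides_primepow_nat)

lemma generate_singleton: "x \<in> carrier G \<Longrightarrow> generate G {x} = range (\<lambda>n::nat. x [^] n)"
  using generate_pow_on_finite_carrier[OF fin] by auto

lemma generate_singleton_subset: "x \<in> carrier G \<Longrightarrow> generate G {x} \<subseteq> carrier G"
  by (intro generate_incl) simp

lemma finite_generate: "x \<in> carrier G \<Longrightarrow> finite (generate G {x})"
  using generate_singleton_subset fin finite_subset by blast

lemma comparable_iff:
  "x \<in> carrier G \<Longrightarrow> y \<in> carrier G \<Longrightarrow>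
    comparable G x y \<longleftrightarrow> x \<in> generate G {y} \<or> y \<in> generate G {x}"
  by (auto simp: comparable_def generate_singleton)

lemma ord_pow_prime_power:
  assumes "x \<in> carrier G" "ord x = p ^ k" "j \<le> k"
  shows "ord (x [^] (p ^ j)) = p ^ (k - j)"
  using assms p_ge_2 by (simp add: ord_pow le_imp_power_dvd power_diff)

lemma ord_if_ord_pow:
  assumes "x \<in> carrier G" "ord (x [^] p) = p ^ k" "k \<ge> 1"
  shows "ord x = p ^ Suc k"
proof -
  obtain j where j: "ord x = p ^ j" using ord_prime_power[OF assms(1)] .
  have "j \<noteq> 0"
  proof
    assume "j = 0"
    then have "x = \<one>" using j ord_eq_1[OF assms(1)] by simp
    then have "p ^ k = 1" using assms(2) ord_id by simp
    moreover have "p ^ k \<noteq> 1" using assms(3) p_ge_2 by (simp add: power_eq_1_iff)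
    ultimately show False by simp
  qed
  then have "p ^ (j - 1) = p ^ k" using ord_pow_prime_power[OF assms(1) j, of 1] assms(2) by simp
  then have "j = Suc k" using p_ge_2 \<open>j \<noteq> 0\<close> by simp
  then show ?thesis using j by simp
qed

text \<open>
  Every \<open>w\<close> in the group generated by \<open>a\<close> generates the same subgroup as \<open>a [^] (ord a div ord w)\<close>,
  which depends on the order of \<open>w\<close> only.
\<close>

lemma generate_eq_if_same_ord:
  assumes "a \<in> carrier G" "u \<in> generate G {a}" "v \<in> generate G {a}" "ord u = ord v"
  shows "generate G {u} = generate G {v}"
proof -
  have *: "generate G {w} = generate G {a [^] (ord a div ord w)}" if w: "w \<in> generate G {a}" for w
  proof -
    have wc: "w \<in> carrier G" using w generate_singleton_subset[OF assms(1)] by blast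
    obtain i :: nat where i: "w = a [^] i" using w generate_singleton[OF assms(1)] by auto
    have "w [^] ord a = a [^] (i * ord a)" using assms(1) i by (simp add: nat_pow_pow)
    also have "\<dots> = \<one>" using assms(1) by (simp add: pow_eq_id)
    finally have dvd: "ord w dvd ord a" using pow_eq_id[OF wc] by simp
    define c where "c = ord a div ord w"
    have c: "ord a = c * ord w" using dvd by (simp add: c_def)
    have "a [^] (i * ord w) = \<one>" 
      unfolding nat_pow_pow[OF assms(1), symmetric] using pow_ord_eq_1[OF wc] i by simp
    then have "c * ord w dvd i * ord w" using assms(1) c by (simp add: pow_eq_id)
    then have "c dvd i" using ord_pos[OF wc] by simp
    then obtain m where "i = c * m" by blast
    then have "w = (a [^] c) [^] m" using i assms(1) by (simp add: nat_pow_pow)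
    then have "w \<in> generate G {a [^] c}" using assms(1) by (simp add: generate_singleton)
    then have sub: "generate G {w} \<subseteq> generate G {a [^] c}"
      using generate_singleton_mono assms(1) by simp
    have "c dvd ord a" using c by simp
    moreover have "c \<noteq> 0" using c ord_pos[OF assms(1)] by auto
    ultimately have "ord (a [^] c) = ord a div c" using assms(1) by (intro ord_pow) auto
    then have "ord (a [^] c) = ord w" using c \<open>c \<noteq> 0\<close> by simp
    then have "card (generate G {w}) = card (generate G {a [^] c})"
      using generate_pow_card assms(1) wc by simp
    then show ?thesis
      using card_subset_eq[OF finite_generate sub] assms(1) by (simp add: c_def)
  qed
  show ?thesis using *[OF assms(2)] *[OF assms(3)] assms(4) by simp
qed

lemma ex_power_of_order_p:
  assumes "x \<in> carrier G" "x \<noteq> \<one>"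
  obtains j :: nat where "ord (x [^] j) = p"
proof -
  obtain k where k: "ord x = p ^ k" using ord_prime_power[OF assms(1)] .
  have "k \<noteq> 0" using k ord_eq_1[OF assms(1)] assms(2) by (metis power_0)
  then have "ord (x [^] (p ^ (k - 1))) = p"
    using ord_pow_prime_power[OF assms(1) k, of "k - 1"] by simp
  then show ?thesis using that by blast
qed

section \<open>Central elements modulo a normal subgroup\<close>

text \<open>
  The conjugacy classes of noncentral elements have sizes divisible by \<open>p\<close>, while \<open>N\<close> without the
  identity does not, so that some class in it is a single central element. A power of that element has
  order \<open>p\<close>.
\<close>

lemma normal_meets_centre:
  assumes N: "N \<lhd> G" and "N \<noteq> {\<one>}"
  shows "\<exists>x \<in> N. ord x = p \<and> (\<forall>g \<in> carrier G. g \<otimes> x = x \<otimes> g)"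
proof -
  let ?\<phi> = "\<lambda>g. \<lambda>h \<in> carrier G. g \<otimes> h \<otimes> inv g"
  interpret conj: group_action G "carrier G" ?\<phi> by (rule action_by_conjugation)
  have sub: "subgroup N G" using N normal_imp_subgroup by blast
  have NG: "N \<subseteq> carrier G" using subgroup.subset[OF sub] .
  have finN: "finite N" using NG fin finite_subset by blast
  have oneN: "\<one> \<in> N" using subgroup.one_closed[OF sub] .
  have ex: "\<exists>x \<in> N - {\<one>}. \<forall>g \<in> carrier G. g \<otimes> x = x \<otimes> g"
  proof (rule ccontr)
    assume none: "\<not> ?thesis"
    let ?C = "(\<lambda>x. orbit G ?\<phi> x) ` (N - {\<one>})"
    have orb: "orbit G ?\<phi> x = {g \<otimes> x \<otimes> inv g | g. g \<in> carrier G}" if "x \<in> N" for x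
      using that NG by (auto simp: orbit_def)
    have sub': "orbit G ?\<phi> x \<subseteq> N - {\<one>}" if x: "x \<in> N - {\<one>}" for x
    proof
      fix y assume "y \<in> orbit G ?\<phi> x"
      then obtain g where g: "g \<in> carrier G" "y = g \<otimes> x \<otimes> inv g" using orb x by auto
      have xc: "x \<in> carrier G" using x NG by auto
      have "y \<in> N" using normal.inv_op_closed2[OF N g(1)] x g(2) by auto
      moreover have "y \<noteq> \<one>"
      proof
        assume "y = \<one>"
        then have "g \<otimes> x = g" using g xc by (metis inv_closed inv_inv inv_equality m_closed)
        then show False using x xc g by simp
      qed
      ultimately show "y \<in> N - {\<one>}" by simp
    qed
    have U: "\<Union>?C = N - {\<one>}"
    proof
      show "N - {\<one>} \<subseteq> \<Union>?C" using conj.orbit_refl NG by blast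
    qed (use sub' in blast)
    have "p dvd card (\<Union>?C)"
    proof (rule dvd_partition)
      show "finite (\<Union>?C)" unfolding U using finN by simp
      show "\<forall>c1\<in>?C. \<forall>c2\<in>?C. c1 \<noteq> c2 \<longrightarrow> c1 \<inter> c2 = {}"
      proof (intro ballI impI)
        fix c1 c2 assume "c1 \<in> ?C" "c2 \<in> ?C" "c1 \<noteq> c2"
        moreover have "?C \<subseteq> orbits G (carrier G) ?\<phi>" using NG by (auto simp: orbits_def)
        ultimately show "c1 \<inter> c2 = {}" using conj.disjoint_union by blast
      qed
      show "\<forall>c\<in>?C. p dvd card c"
      proof
        fix c assume "c \<in> ?C"
        then obtain x where x: "x \<in> N - {\<one>}" "c = orbit G ?\<phi> x" by auto
        have xc: "x \<in> carrier G" using x NG by auto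
        have size: "card c * card (stabilizer G ?\<phi> x) = p ^ n"
          using conj.orbit_stabilizer_theorem[OF xc] by (simp only: x(2) order_eq)
        have "card c dvd p ^ n" unfolding size[symmetric] by (rule dvd_triv_left)
        then obtain i where i: "card c = p ^ i" using prime by (auto simp: divides_primepow_nat)
        obtain g where g: "g \<in> carrier G" "g \<otimes> x \<noteq> x \<otimes> g" using none x by blast
        have xin: "x \<in> c" using conj.orbit_refl[OF xc] x by simp
        have gin: "g \<otimes> x \<otimes> inv g \<in> c" using orb x g by auto
        have ne: "g \<otimes> x \<otimes> inv g \<noteq> x" using g xc by (metis inv_solve_right' m_closed)
        have "finite c" using sub'[OF x(1)] finN x(2) finite_subset by blast
        then have "card {x, g \<otimes> x \<otimes> inv g} \<le> card c" using xin gin by (intro card_mono) auto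
        then have "i \<noteq> 0" using i ne by (cases i) auto
        then show "p dvd card c" using i by simp
      qed
    qed
    then have "p dvd card N - 1" unfolding U using finN oneN by simp
    moreover have "p dvd card N"
    proof -
      have "card N dvd p ^ n" using lagrange[OF sub] order_eq by (metis dvd_triv_right)
      then obtain i where i: "card N = p ^ i" using prime by (auto simp: divides_primepow_nat)
      have "i \<noteq> 0"
      proof
        assume "i = 0"
        then have "card N = 1" using i by simp
        then obtain y where "N = {y}" by (rule card_1_singletonE)
        then show False using assms(2) oneN by simp
      qed
      then show ?thesis using i by simp
    qed
    moreover have "card N > 0" using finN oneN card_gt_0_iff by blast
    ultimately have "p dvd 1" by (metis Suc_leI dvd_diffD1 One_nat_def)
    then show False using p_ge_2 by simp
  qed
  then obtain x where x: "x \<in> N" "x \<noteq> \<one>" "\<And>g. g \<in> carrier G \<Longrightarrow> g \<otimes> x = x \<otimes> g" by blast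
  have xc: "x \<in> carrier G" using x NG by auto
  obtain j :: nat where j: "ord (x [^] j) = p" using ex_power_of_order_p[OF xc x(2)] .
  have "x [^] j \<in> N" using subgroup.one_closed[OF sub] subgroup.m_closed[OF sub] x(1)
    by (induction j) auto
  moreover have "g \<otimes> x [^] j = x [^] j \<otimes> g" if "g \<in> carrier G" for g
    using group_commutes_pow[of x g j] x(3)[OF that] that xc by simp
  ultimately show ?thesis using j by blast
qed

text \<open>
  The preceding lemma for the image of \<open>H\<close> in the quotient by \<open>A\<close>, pulled back to \<open>G\<close>.
\<close>

lemma central_modulo_normal:
  assumes A: "A \<lhd> G" and H: "H \<lhd> G" and AH: "A \<subset> H"
  shows "\<exists>x \<in> H - A. x [^] p \<in> A \<and> (\<forall>g \<in> carrier G. g \<otimes> x \<otimes> inv g \<otimes> inv x \<in> A)"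
proof -
  interpret A: normal A G by (rule A)
  interpret H: normal H G by (rule H)
  let ?h = "\<lambda>x. A #> x"
  let ?Q = "G Mod A"
  have Qgrp: "group ?Q" by (rule A.factorgroup_is_group)
  have hom: "?h \<in> hom G ?Q" by (rule A.r_coset_hom_Mod)
  have "order ?Q * card A = p ^ n"
    using lagrange[OF A.subgroup_axioms] order_eq by (simp add: order_def FactGroup_def)
  then have "order ?Q dvd p ^ n" by (metis dvd_triv_left)
  then obtain k where k: "order ?Q = p ^ k" using prime by (auto simp: divides_primepow_nat)
  have finQ: "finite (carrier ?Q)" using fin by (simp add: carrier_FactGroup)
  interpret Q: p_group ?Q p k
    using Qgrp prime finQ k by (simp add: p_group_def p_group_axioms_def)
  interpret h: group_hom G ?Q ?h
    by (intro group_hom.intro group_hom_axioms.intro hom Qgrp is_group)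
  have ker: "?h x = \<one>\<^bsub>?Q\<^esub> \<longleftrightarrow> x \<in> A" if "x \<in> carrier G" for x
    using that A.subgroup_axioms coset_join1[of A x] coset_join2[OF that] by auto
  have N: "?h ` H \<lhd> ?Q"
    by (rule H.surj_hom_normal_subgroup[OF h.group_hom_axioms]) (simp add: carrier_FactGroup)
  obtain y where y: "y \<in> H" "y \<notin> A" using AH by blast
  then have "?h y \<noteq> \<one>\<^bsub>?Q\<^esub>" using ker[OF H.mem_carrier[OF y(1)]] by simp
  then have "?h ` H \<noteq> {\<one>\<^bsub>?Q\<^esub>}" using y(1) by blast
  then obtain X where X: "X \<in> ?h ` H" "Q.ord X = p"
      "\<And>B. B \<in> carrier ?Q \<Longrightarrow> B \<otimes>\<^bsub>?Q\<^esub> X = X \<otimes>\<^bsub>?Q\<^esub> B"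
    using Q.normal_meets_centre[OF N] by blast
  then obtain x where x: "x \<in> H" "X = ?h x" by blast
  have xc: "x \<in> carrier G" using H.mem_carrier[OF x(1)] .
  have "x \<notin> A"
  proof
    assume "x \<in> A"
    then have "X = \<one>\<^bsub>?Q\<^esub>" using ker[OF xc] x(2) by simp
    then show False using X(2) Q.ord_id p_ge_2 by simp
  qed
  moreover have "x [^] p \<in> A"
  proof -
    have "?h (x [^] p) = X [^]\<^bsub>?Q\<^esub> p" using h.hom_nat_pow[OF xc] x(2) by simp
    also have "\<dots> = \<one>\<^bsub>?Q\<^esub>" 
      using Q.pow_ord_eq_1[of X] X(2) h.hom_closed[OF xc] x(2) by metis
    finally show ?thesis using ker[of "x [^] p"] xc by simp
  qed
  moreover have "g \<otimes> x \<otimes> inv g \<otimes> inv x \<in> A" if g: "g \<in> carrier G" for g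
  proof -
    have "?h (g \<otimes> x) = ?h (x \<otimes> g)"
      using X(3)[OF h.hom_closed[OF g]] h.hom_mult[OF g xc] h.hom_mult[OF xc g] x(2) by simp
    then have "?h ((g \<otimes> x) \<otimes> inv (x \<otimes> g)) = \<one>\<^bsub>?Q\<^esub>"
      using h.hom_mult[of "g \<otimes> x" "inv (x \<otimes> g)"] h.hom_inv[of "x \<otimes> g"] h.hom_closed[of "x \<otimes> g"] g xc
      by (simp only: m_closed inv_closed Q.r_inv)
    then have "(g \<otimes> x) \<otimes> inv (x \<otimes> g) \<in> A"
      using ker[of "(g \<otimes> x) \<otimes> inv (x \<otimes> g)"] g xc by (simp only: m_closed inv_closed)
    then show ?thesis using g xc by (simp add: inv_mult_group m_assoc)
  qed
  ultimately show ?thesis using x(1) by blast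
qed

end

section \<open>p-groups with a single subgroup of order p\<close>

context p_group
begin

lemma ord_prime_iff: "x \<in> carrier G \<Longrightarrow> ord x = p \<longleftrightarrow> x \<noteq> \<one> \<and> x [^] p = \<one>"
  using prime ord_eq_1[of x] by (auto simp: pow_eq_id prime_nat_iff)

text \<open>
  Since \<open>x [^] p\<close> commutes with \<open>a\<close>, \<open>r ^ p\<close> is \<open>1\<close> modulo \<open>p\<close>, and so is \<open>r\<close> by Fermat. An element of
  order 4 fixed by \<open>x\<close> determines \<open>r\<close> modulo 4; if \<open>a\<close> has order 2, then \<open>r = 1\<close> is a valid choice.
\<close>

lemma twist_exponent:
  assumes a: "a \<in> carrier G" "a \<noteq> \<one>" and x: "x \<in> carrier G"
    and nrm: "x \<otimes> a \<otimes> inv x \<in> generate G {a}" and xp: "x [^] p \<in> generate G {a}"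
    and comm: "p = 2 \<Longrightarrow> ord a = 2 \<or> (\<exists>d \<in> generate G {a}. ord d = 4 \<and> x \<otimes> d = d \<otimes> x)"
  shows "\<exists>r::nat. x \<otimes> a = a [^] r \<otimes> x \<and> [r = 1] (mod p) \<and> (p = 2 \<longrightarrow> [r = 1] (mod 4))"
proof -
  obtain r :: nat where "x \<otimes> a \<otimes> inv x = a [^] r" using nrm generate_singleton[OF a(1)] by auto
  then have r: "x \<otimes> a = a [^] r \<otimes> x" using a x by (metis inv_solve_right' m_closed nat_pow_closed)
  obtain i :: nat where i: "x [^] p = a [^] i" using xp generate_singleton[OF a(1)] by auto
  have "a [^] i \<otimes> a [^] (1::nat) = a [^] (1 * r ^ p) \<otimes> a [^] i"
    using twisted_pow[OF a(1) x r, of p 1] by (simp only: i)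
  then have "a [^] (1 * r ^ p) \<otimes> a [^] i = a [^] (1::nat) \<otimes> a [^] i"
    using nat_pow_comm[OF a(1), of i 1] by (simp only:)
  then have "a [^] (1 * r ^ p) = a [^] (1::nat)" using a(1) by (simp del: nat_pow_eone)
  then have rp: "[r ^ p = 1] (mod ord a)" 
    using pow_eq_iff_cong[OF a(1), of "r ^ p" 1] by (simp only: mult_1)
  obtain k where k: "ord a = p ^ k" using ord_prime_power[OF a(1)] .
  have "k \<noteq> 0" using k ord_eq_1[OF a(1)] a(2) by (metis power_0)
  then have "p dvd ord a" using k by simp
  then have rp1: "[r ^ p = 1] (mod p)" using rp cong_dvd_modulus_nat by blast
  have r1: "[r = 1] (mod p)"
  proof -
    have nd: "\<not> p dvd r"
    proof
      assume "p dvd r"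
      then have "[r ^ p = 0] (mod p)" using p_ge_2 by (simp add: cong_0_iff dvd_power_same dvd_trans[OF _ dvd_power])
      then have "[1 = 0] (mod p)" using rp1 cong_trans cong_sym by blast
      then show False using p_ge_2 by (simp add: cong_0_iff)
    qed
    have "[r ^ (p - 1) * r = 1 * r] (mod p)"
      using fermat_theorem[OF prime nd] by (intro cong_mult) auto
    moreover have "r ^ (p - 1) * r = r ^ p" using p_ge_2 by (intro power_minus_mult) simp
    ultimately show ?thesis using rp1 by (metis cong_sym cong_trans mult_1)
  qed
  show ?thesis
  proof (cases "p = 2 \<and> ord a = 2")
    case True
    then have "a [^] r = a [^] (1::nat)" using pow_eq_iff_cong[OF a(1), of r 1] r1 by simp
    then have "x \<otimes> a = a [^] (1::nat) \<otimes> x" using r by simp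
    then show ?thesis by (intro exI[of _ 1]) auto
  next
    case False
    have "[r = 1] (mod 4)" if "p = 2"
    proof -
      have "\<exists>d \<in> generate G {a}. ord d = 4 \<and> x \<otimes> d = d \<otimes> x"
        using comm[OF that] False that by blast
      then obtain d where d: "d \<in> generate G {a}" "ord d = 4" "x \<otimes> d = d \<otimes> x" by blast
      then obtain j :: nat where j: "d = a [^] j" using generate_singleton[OF a(1)] by auto
      have dc: "d \<in> carrier G" using j a by simp
      have "x \<otimes> d = d [^] r \<otimes> x"
        using twisted_pow[OF a(1) x r, of 1 j] a x by (simp add: j nat_pow_pow)
      then have "d [^] r \<otimes> x = d [^] (1::nat) \<otimes> x" using d(3) dc by simp
      then have "d [^] r = d [^] (1::nat)" using dc x by (simp del: nat_pow_eone)
      then show ?thesis using pow_eq_iff_cong[OF dc, of r 1] d(2) by (simp only:)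
    qed
    then show ?thesis using r r1 by blast
  qed
qed

text \<open>
  The \<open>p\<close>-th power of \<open>a [^] j \<otimes> x\<close> is \<open>a [^] (p * (j * s + m))\<close> with \<open>s\<close> prime to \<open>p\<close>, so \<open>j\<close> can be
  chosen to make it trivial.
\<close>

lemma ex_order_p_outside_cyclic:
  assumes a: "a \<in> carrier G" and x: "x \<in> carrier G" "x \<notin> generate G {a}"
    and r: "x \<otimes> a = a [^] (r::nat) \<otimes> x" "[r = 1] (mod p)" "p = 2 \<Longrightarrow> [r = 1] (mod 4)"
    and xp: "x [^] p = a [^] (p * m)"
  shows "\<exists>y \<in> carrier G - generate G {a}. ord y = p"
proof -
  obtain s where s: "(\<Sum>i<p. r ^ i) = p * s" "\<not> p dvd s"
    using power_sum_prime[OF prime r(2,3)] by blast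
  obtain k where k: "ord a = p ^ k" using ord_prime_power[OF a] .
  have "coprime p s" using s(2) prime by (simp add: prime_imp_coprime)
  then have "coprime s (ord a)" using k by (simp add: coprime_commute)
  then obtain u where u: "[s * u = 1] (mod ord a)" using cong_solve_coprime_nat[of s "ord a"] by auto
  \<comment> \<open>\<open>j\<close> is \<open>- m / s\<close> modulo the order of \<open>a\<close>, with \<open>ord a - 1\<close> in place of \<open>- 1\<close>.\<close>
  define j where "j = u * (m * (ord a - 1))"
  have "[s * u * (m * (ord a - 1)) + m = 1 * (m * (ord a - 1)) + m] (mod ord a)"
    by (intro cong_add cong_mult u cong_refl)
  moreover have "1 * (m * (ord a - 1)) + m = m * ord a"
    using ord_pos[OF a] by (cases "ord a") (auto simp: algebra_simps)
  moreover have "j * s = s * u * (m * (ord a - 1))" by (simp add: j_def ac_simps)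
  ultimately have "[j * s + m = m * ord a] (mod ord a)" by (simp only:)
  then have "ord a dvd j * s + m" by (simp add: cong_def dvd_eq_mod_eq_0)
  then have dvd: "ord a dvd j * (p * s) + p * m"
    by (metis distrib_left dvd_mult mult.left_commute)
  define y where "y = a [^] j \<otimes> x"
  have yc: "y \<in> carrier G" using a x by (simp add: y_def)
  have "y [^] p = a [^] (j * (p * s)) \<otimes> a [^] (p * m)"
    using twisted_product_pow[OF a x(1) r(1), of j p] by (simp only: y_def s xp)
  also have "\<dots> = \<one>" using a dvd by (simp add: nat_pow_mult pow_eq_id)
  finally have yp: "y [^] p = \<one>" .
  have sub: "subgroup (generate G {a}) G" using a by (intro generate_is_subgroup) simp
  have aj: "a [^] j \<in> generate G {a}" using generate_singleton[OF a] by auto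
  have ynot: "y \<notin> generate G {a}"
  proof
    assume "y \<in> generate G {a}"
    then have "inv (a [^] j) \<otimes> y \<in> generate G {a}"
      using aj subgroup.m_closed[OF sub] subgroup.m_inv_closed[OF sub] by blast
    moreover have "inv (a [^] j) \<otimes> y = x" using a x by (simp add: y_def m_assoc[symmetric])
    ultimately show False using x(2) by simp
  qed
  then have "y \<noteq> \<one>" using generate.one by metis
  then show ?thesis using ord_prime_iff[OF yc] yp yc ynot by blast
qed

lemma normal_generate_iff:
  assumes "a \<in> carrier G"
  shows "generate G {a} \<lhd> G \<longleftrightarrow> (\<forall>g \<in> carrier G. g \<otimes> a \<otimes> inv g \<in> generate G {a})"
proof
  assume "generate G {a} \<lhd> G"
  then show "\<forall>g \<in> carrier G. g \<otimes> a \<otimes> inv g \<in> generate G {a}"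
    using generate.incl[of a "{a}" G] by (simp add: normal_inv_iff)
next
  assume *: "\<forall>g \<in> carrier G. g \<otimes> a \<otimes> inv g \<in> generate G {a}"
  have sub: "subgroup (generate G {a}) G" using assms by (intro generate_is_subgroup) simp
  have "g \<otimes> h \<otimes> inv g \<in> generate G {a}" if g: "g \<in> carrier G" and h: "h \<in> generate G {a}" for g h
  proof -
    obtain i :: nat where "h = a [^] i" using h generate_singleton[OF assms] by auto
    then have "g \<otimes> h \<otimes> inv g = (g \<otimes> a \<otimes> inv g) [^] i" using conjugate_pow g assms by simp
    also have "\<dots> \<in> generate G {g \<otimes> a \<otimes> inv g}" using generate_singleton assms g by auto
    also have "\<dots> \<subseteq> generate G {a}" using generate_singleton_mono assms * g by blast
    finally show ?thesis .
  qed
  then show "generate G {a} \<lhd> G" using sub by (simp add: normal_inv_iff)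
qed

text \<open>
  Otherwise \<open>H\<close> contains an element \<open>x\<close> outside \<open>A = generate G {a}\<close> that is central and of order \<open>p\<close>
  modulo \<open>A\<close>, say \<open>x [^] p = a [^] m\<close>. If \<open>p\<close> does not divide \<open>m\<close>, then \<open>x\<close> generates a larger normal
  cyclic subgroup; if it does, multiplying \<open>x\<close> by an element of \<open>A\<close> gives an element of order \<open>p\<close>
  outside \<open>A\<close>, although \<open>A\<close> already contains the unique subgroup of order \<open>p\<close>.
\<close>

lemma maximal_normal_cyclic_self_centralizing:
  assumes unique: "\<And>u v. u \<in> carrier G \<Longrightarrow> v \<in> carrier G \<Longrightarrow> ord u = p \<Longrightarrow> ord v = p \<Longrightarrow> v \<in> generate G {u}"
    and a: "a \<in> carrier G" "a \<noteq> \<one>" "generate G {a} \<lhd> G"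
    and max: "\<And>b. b \<in> carrier G \<Longrightarrow> generate G {b} \<lhd> G \<Longrightarrow> ord b \<le> ord a"
    and H: "H \<lhd> G" "generate G {a} \<subseteq> H"
    and comm: "p = 2 \<Longrightarrow> ord a = 2 \<or> (\<exists>d \<in> generate G {a}. ord d = 4 \<and> (\<forall>x \<in> H. x \<otimes> d = d \<otimes> x))"
  shows "H = generate G {a}"
proof (rule ccontr)
  assume "H \<noteq> generate G {a}"
  then have psubset: "generate G {a} \<subset> H" using H(2) by blast
  obtain x where "x \<in> H - generate G {a}"
    and *: "x [^] p \<in> generate G {a} \<and> (\<forall>g \<in> carrier G. g \<otimes> x \<otimes> inv g \<otimes> inv x \<in> generate G {a})"
    using central_modulo_normal[OF a(3) H(1) psubset] by (rule bexE)
  then have x: "x \<in> H" "x \<notin> generate G {a}" "x [^] p \<in> generate G {a}"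
      "\<And>g. g \<in> carrier G \<Longrightarrow> g \<otimes> x \<otimes> inv g \<otimes> inv x \<in> generate G {a}" by auto
  have xc: "x \<in> carrier G" 
    using subgroup.mem_carrier[OF normal_imp_subgroup[OF H(1)] x(1)] .
  have sub: "subgroup (generate G {b}) G" if "b \<in> carrier G" for b
    using that by (intro generate_is_subgroup) simp
  obtain m :: nat where m: "x [^] p = a [^] m" using x(3) generate_singleton[OF a(1)] by auto
  obtain k where k: "ord a = p ^ k" using ord_prime_power[OF a(1)] .
  have "p dvd m"
  proof (rule ccontr)
    assume "\<not> p dvd m"
    then have "coprime p m" using prime prime_imp_coprime by blast
    then have "coprime m (ord a)" using k by (simp add: coprime_commute)
    then have ord: "ord (a [^] m) = ord a" using pow_ord_eq_ord_iff[OF fin a(1)] by simp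
    have "a [^] m \<in> generate G {a}" using generate_singleton[OF a(1)] by auto
    then have "generate G {a [^] m} = generate G {a}"
      using ord generate.incl[of a "{a}" G] by (intro generate_eq_if_same_ord[OF a(1)]) auto
    moreover have xpx: "x [^] p \<in> generate G {x}" using generate_singleton[OF xc] by auto
    ultimately have ax: "generate G {a} \<subseteq> generate G {x}"
      using generate_singleton_mono[OF xc xpx] m by simp
    have xx: "x \<in> generate G {x}" using generate.incl[of x "{x}" G] by simp
    have "g \<otimes> x \<otimes> inv g \<in> generate G {x}" if g: "g \<in> carrier G" for g
    proof -
      have eq: "g \<otimes> x \<otimes> inv g = (g \<otimes> x \<otimes> inv g \<otimes> inv x) \<otimes> x" using g xc by (simp add: m_assoc)
      show ?thesis
        by (subst eq) (rule subgroup.m_closed[OF sub[OF xc] subsetD[OF ax x(4)[OF g]] xx])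
    qed
    then have "generate G {x} \<lhd> G" using normal_generate_iff[OF xc] by blast
    then have "card (generate G {x}) \<le> card (generate G {a})"
      using max[OF xc] generate_pow_card xc a(1) by simp
    then have "generate G {a} = generate G {x}"
      using card_seteq[OF finite_generate[OF xc] ax] by blast
    then show False using x(2) xx by simp
  qed
  then obtain m' where "m = p * m'" by blast
  then have xp: "x [^] p = a [^] (p * m')" using m by simp
  have "\<exists>r::nat. x \<otimes> a = a [^] r \<otimes> x \<and> [r = 1] (mod p) \<and> (p = 2 \<longrightarrow> [r = 1] (mod 4))"
    using a(3) xc normal_generate_iff[OF a(1)] x(1,3) comm by (intro twist_exponent[OF a(1,2) xc]) blast+
  then obtain y where y: "y \<in> carrier G" "y \<notin> generate G {a}" "ord y = p"
    using ex_order_p_outside_cyclic[OF a(1) xc x(2) _ _ _ xp] by blast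
  obtain j :: nat where j: "ord (a [^] j) = p" using ex_power_of_order_p[OF a(1,2)] .
  have "y \<in> generate G {a [^] j}" using unique[OF _ y(1) j y(3)] a(1) by simp
  then show False using generate_singleton_mono[OF a(1), of "a [^] j"] generate_singleton[OF a(1)] y(2) by auto
qed

lemma ex_maximal_normal_cyclic:
  assumes "order G \<noteq> 1"
  obtains a where "a \<in> carrier G" "a \<noteq> \<one>" "generate G {a} \<lhd> G"
    "\<And>b. b \<in> carrier G \<Longrightarrow> generate G {b} \<lhd> G \<Longrightarrow> ord b \<le> ord a"
proof -
  have carr: "carrier G \<lhd> G" by (simp add: normal_inv_iff subgroup_self)
  have "carrier G \<noteq> {\<one>}" using assms by (auto simp: order_def)
  then obtain c where c: "c \<in> carrier G" "ord c = p" "\<And>g. g \<in> carrier G \<Longrightarrow> g \<otimes> c = c \<otimes> g"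
    using normal_meets_centre[OF carr] by blast
  have "g \<otimes> c \<otimes> inv g = c" if "g \<in> carrier G" for g
    using c that by (simp add: m_assoc)
  then have "generate G {c} \<lhd> G" using normal_generate_iff[OF c(1)] generate.incl[of c "{c}" G] by simp
  then have P: "c \<in> carrier G \<and> generate G {c} \<lhd> G" using c by simp
  define S where "S = {b \<in> carrier G. generate G {b} \<lhd> G}"
  have S: "finite (ord ` S)" "ord ` S \<noteq> {}" using fin P by (auto simp: S_def)
  then have "Max (ord ` S) \<in> ord ` S" by (intro Max_in)
  then obtain a where a: "ord a = Max (ord ` S)" "a \<in> S" by (metis imageE)
  have "a \<in> carrier G \<and> generate G {a} \<lhd> G \<and> (\<forall>b. b \<in> carrier G \<and> generate G {b} \<lhd> G \<longrightarrow> ord b \<le> ord a)"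
    using a(2) Max_ge[OF S(1)] unfolding a(1) by (simp add: S_def)
  moreover have "a \<noteq> \<one>"
  proof
    assume "a = \<one>"
    then have "p \<le> 1" using calculation P c(2) by (metis ord_id)
    then show False using p_ge_2 by simp
  qed
  ultimately show ?thesis using that by blast
qed

lemma involution_unique_in_generate:
  assumes "u \<in> carrier G" "ord u = 2" "v \<in> generate G {u}" "v \<noteq> \<one>"
  shows "v = u"
proof -
  have "card (generate G {u}) = 2" using generate_pow_card[OF assms(1)] assms(2) by simp
  moreover have "\<one> \<in> generate G {u}" "u \<in> generate G {u}"
    using generate.one generate.incl[of u "{u}" G] by auto
  moreover have "u \<noteq> \<one>" using assms(2) by auto
  ultimately show ?thesis using assms(3,4) by (auto simp: card_2_iff)
qed

lemma conjugate_of_order_4: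
  assumes d: "d \<in> carrier G" "ord d = 4" and g: "g \<in> carrier G" "g \<otimes> d \<otimes> inv g \<in> generate G {d}"
    and nc: "g \<otimes> d \<noteq> d \<otimes> g"
  shows "g \<otimes> d \<otimes> inv g = inv d"
proof -
  obtain i :: nat where i: "g \<otimes> d \<otimes> inv g = d [^] i" using g generate_singleton[OF d(1)] by auto
  then have i': "g \<otimes> d \<otimes> inv g = d [^] (i mod 4)"
    using pow_eq_iff_cong[OF d(1), of i "i mod 4"] d(2) by (simp add: cong_def)
  have gd: "g \<otimes> d = d [^] (i mod 4) \<otimes> g" using i' g d by (metis inv_solve_right' m_closed nat_pow_closed)
  have "i mod 4 < 4" by simp
  then consider "i mod 4 = 0" | "i mod 4 = 1" | "i mod 4 = 2" | "i mod 4 = 3" by linarith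
  then show ?thesis
  proof cases
    case 1
    then have "g \<otimes> d = g" using gd g by simp
    then have "d = \<one>" using g d by simp
    then show ?thesis using d by simp
  next
    case 2
    then show ?thesis using gd nc d by simp
  next
    case 3
    have "(g \<otimes> d \<otimes> inv g) [^] (2::nat) = d [^] (4::nat)" using 3 i' d by (simp add: nat_pow_pow)
    also have "\<dots> = \<one>" using pow_eq_id[OF d(1)] d(2) by simp
    finally have "g \<otimes> d [^] (2::nat) \<otimes> inv g = \<one>" using conjugate_pow[OF g(1) d(1), of 2] by simp
    then have "g \<otimes> d [^] (2::nat) = g" using g d by (metis inv_closed inv_equality inv_inv m_closed nat_pow_closed)
    then have "d [^] (2::nat) = \<one>" using g d by simp
    then have "4 dvd (2::nat)" using pow_eq_id[OF d(1), of 2] d(2) by simp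
    then show ?thesis by simp
  next
    case 4
    have "d [^] (3::nat) \<otimes> d = d [^] (4::nat)" using nat_pow_Suc[of d 3] by simp
    also have "\<dots> = \<one>" using pow_eq_id[OF d(1)] d(2) by simp
    finally have "inv d = d [^] (3::nat)" using d inv_equality by simp
    then show ?thesis using 4 i' by simp
  qed
qed

text \<open>
  Conjugation maps \<open>d\<close> to \<open>d\<close> or to its inverse, so the centralizer has index at most two; the second
  conclusion is the form in which this is used.
\<close>

lemma centralizer_of_order_4:
  assumes d: "d \<in> carrier G" "ord d = 4" "\<And>g. g \<in> carrier G \<Longrightarrow> g \<otimes> d \<otimes> inv g \<in> generate G {d}"
  defines "H \<equiv> {g \<in> carrier G. g \<otimes> d = d \<otimes> g}"
  shows "H \<lhd> G"
    and "\<And>g h. g \<in> carrier G - H \<Longrightarrow> h \<in> carrier G - H \<Longrightarrow> g \<otimes> h \<in> H"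
proof -
  have H: "g \<in> H \<longleftrightarrow> g \<in> carrier G \<and> g \<otimes> d \<otimes> inv g = d" for g
  proof (cases "g \<in> carrier G")
    case True
    then show ?thesis using d(1) inv_solve_right'[of d "g \<otimes> d" g] by (auto simp: H_def)
  qed (simp add: H_def)
  have mult: "(g \<otimes> h) \<otimes> d \<otimes> inv (g \<otimes> h) = g \<otimes> (h \<otimes> d \<otimes> inv h) \<otimes> inv g"
    if "g \<in> carrier G" "h \<in> carrier G" for g h
    using that d(1) by (simp add: inv_mult_group m_assoc)
  have sub: "subgroup H G"
  proof (rule subgroupI)
    show "H \<subseteq> carrier G" by (auto simp: H_def)
    show "H \<noteq> {}" using d(1) by (auto simp: H_def intro!: exI[of _ \<one>])
    show "inv g \<in> H" if "g \<in> H" for g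
    proof -
      have g: "g \<in> carrier G" "g \<otimes> d = d \<otimes> g" using that by (auto simp: H_def)
      have "inv g \<otimes> d = inv g \<otimes> (d \<otimes> g) \<otimes> inv g" using g(1) d(1) by (simp add: m_assoc)
      also have "\<dots> = d \<otimes> inv g" unfolding g(2)[symmetric] using g(1) d(1) by (simp add: m_assoc[symmetric])
      finally show ?thesis using g(1) by (simp add: H_def)
    qed
    show "g \<otimes> h \<in> H" if "g \<in> H" "h \<in> H" for g h
      using that mult by (simp add: H)
  qed
  have inverts: "g \<otimes> d \<otimes> inv g = inv d" if "g \<in> carrier G - H" for g
    using conjugate_of_order_4[OF d(1,2) _ d(3)] that by (auto simp: H_def)
  have inv2: "g \<otimes> inv d \<otimes> inv g = inv (g \<otimes> d \<otimes> inv g)" if "g \<in> carrier G" for g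
    using that d(1) by (simp add: inv_mult_group m_assoc)
  show prod: "g \<otimes> h \<in> H" if "g \<in> carrier G - H" "h \<in> carrier G - H" for g h
    using that mult[of g h] inverts inv2[of g] d(1) by (simp add: H)
  have "g \<otimes> h \<otimes> inv g \<in> H" if g: "g \<in> carrier G" and h: "h \<in> H" for g h
  proof (cases "g \<in> H")
    case True
    then show ?thesis
      using h subgroup.m_closed[OF sub] subgroup.m_inv_closed[OF sub] by blast
  next
    case False
    have hc: "h \<in> carrier G" using h by (simp add: H_def)
    have out: "x \<otimes> y \<notin> H" if "x \<in> carrier G" "x \<notin> H" "y \<in> H" for x y
    proof
      assume "x \<otimes> y \<in> H"
      then have "(x \<otimes> y) \<otimes> inv y \<in> H"
        using that(3) subgroup.m_closed[OF sub] subgroup.m_inv_closed[OF sub] by blast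
      moreover have "y \<in> carrier G" using that(3) by (simp add: H_def)
      ultimately show False using that by (simp add: m_assoc)
    qed
    have "inv g \<notin> H"
    proof
      assume "inv g \<in> H"
      then have "inv (inv g) \<in> H" by (rule subgroup.m_inv_closed[OF sub])
      then show False using False g by simp
    qed
    then show ?thesis using prod[of "g \<otimes> h" "inv g"] out[OF g False h] g hc by simp
  qed
  then show "H \<lhd> G" using sub by (simp add: normal_inv_iff)
qed

text \<open>
  Let \<open>A\<close>, generated by \<open>a\<close>, be a maximal normal cyclic subgroup. For odd \<open>p\<close> and for \<open>A\<close> of order 2
  it is all of \<open>G\<close>. Otherwise \<open>A\<close> is the centralizer of its elements \<open>d\<close> of order 4, hence of index 2.
  An element \<open>y\<close> outside \<open>A\<close> inverts \<open>d\<close> and commutes with its own square, so the square has order at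
  most 2; it is not trivial, because the only involution lies in \<open>A\<close>. Thus all elements outside \<open>A\<close>
  have the same square, and comparing the squares of \<open>x\<close> and of \<open>x \<otimes> a\<close> yields the last relation.
\<close>

theorem unique_order_p_subgroup:
  assumes unique: "\<And>u v. u \<in> carrier G \<Longrightarrow> v \<in> carrier G \<Longrightarrow> ord u = p \<Longrightarrow> ord v = p \<Longrightarrow> v \<in> generate G {u}"
    and "\<not> cyclic_group G"
  shows "\<exists>k a x. k \<ge> 2 \<and> a \<in> carrier G \<and> x \<in> carrier G \<and> ord a = 2 ^ k \<and> x \<notin> generate G {a} \<and>
    x [^] (2::nat) = a [^] ((2::nat) ^ (k - 1)) \<and> inv x \<otimes> a \<otimes> x = inv a \<and>
    (\<forall>g \<in> carrier G. g \<in> generate G {a} \<or> g \<otimes> inv x \<in> generate G {a})"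
proof -
  have "order G \<noteq> 1"
    using assms(2) trivial_imp_cyclic_group order_one_triv_iff by (metis trivial_group_def is_group)
  then obtain a where a: "a \<in> carrier G" "a \<noteq> \<one>" "generate G {a} \<lhd> G"
    "\<And>b. b \<in> carrier G \<Longrightarrow> generate G {b} \<lhd> G \<Longrightarrow> ord b \<le> ord a"
    using ex_maximal_normal_cyclic by blast
  have self_cent: "K = generate G {a}" if "K \<lhd> G" "generate G {a} \<subseteq> K"
    "p = 2 \<Longrightarrow> ord a = 2 \<or> (\<exists>d \<in> generate G {a}. ord d = 4 \<and> (\<forall>x \<in> K. x \<otimes> d = d \<otimes> x))" for K
    by (rule maximal_normal_cyclic_self_centralizing[OF _ a(1-3) _ that(1,2)])
      (rule unique a(4) that(3); assumption)+
  have carr: "carrier G \<lhd> G" by (simp add: normal_inv_iff subgroup_self)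
  have "generate G {a} = range (\<lambda>n::int. a [^] n)" using generate_pow[OF a(1)] by auto
  then have nc: "carrier G \<noteq> generate G {a}" using assms(2) a(1) cyclic_group by auto
  note sub_carr = generate_singleton_subset[OF a(1)]
  have p: "p = 2" using self_cent[OF carr sub_carr] nc by blast
  obtain k where k: "ord a = 2 ^ k" using ord_prime_power[OF a(1)] p by metis
  have "k \<noteq> 0" using k ord_eq_1[OF a(1)] a(2) by (metis power_0)
  moreover have "k \<noteq> 1" using self_cent[OF carr sub_carr] nc k by auto
  ultimately have k2: "k \<ge> 2" by linarith
  define d where "d = a [^] ((2::nat) ^ (k - 2))"
  define z where "z = a [^] ((2::nat) ^ (k - 1))"
  have ordk: "ord a = p ^ k" using k p by simp
  have d: "d \<in> carrier G" "ord d = 4" "d \<in> generate G {a}"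
    using ord_pow_prime_power[OF a(1) ordk, of "k - 2"] k2 a(1) generate_singleton[OF a(1)] p by (auto simp: d_def)
  have z: "z \<in> carrier G" "ord z = 2" "z \<in> generate G {a}"
    using ord_pow_prime_power[OF a(1) ordk, of "k - 1"] k2 a(1) generate_singleton[OF a(1)] p by (auto simp: z_def)
  have dn: "g \<otimes> d \<otimes> inv g \<in> generate G {d}" if g: "g \<in> carrier G" for g
  proof -
    let ?e = "g \<otimes> d \<otimes> inv g"
    have ec: "?e \<in> carrier G" using g d by simp
    have "?e \<in> generate G {a}" using a(3) g d(3) by (simp add: normal_inv_iff)
    moreover have "ord ?e = ord d"
    proof -
      have "?e [^] n = \<one> \<longleftrightarrow> d [^] n = \<one>" for n :: nat
      proof -
        have "?e [^] n = g \<otimes> d [^] n \<otimes> inv g" using conjugate_pow[OF g d(1)] by simp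
        moreover have "g \<otimes> y \<otimes> inv g = \<one> \<longleftrightarrow> y = \<one>" if "y \<in> carrier G" for y
          using inv_solve_right'[of \<one> "g \<otimes> y" g] g that by simp
        ultimately show ?thesis using d(1) by simp
      qed
      then show ?thesis using ord_unique[OF ec, of "ord d"] pow_eq_id[OF d(1)] by simp
    qed
    ultimately have "generate G {?e} = generate G {d}"
      using generate_eq_if_same_ord[OF a(1)] d(3) by blast
    then show ?thesis using generate.incl[of ?e "{?e}" G] by blast
  qed
  define H where "H = {g \<in> carrier G. g \<otimes> d = d \<otimes> g}"
  note cent = centralizer_of_order_4[OF d(1,2) dn, folded H_def]
  have abel: "u \<otimes> v = v \<otimes> u" if "u \<in> generate G {a}" "v \<in> generate G {a}" for u v
    using that generate_singleton[OF a(1)] nat_pow_comm[OF a(1)] by auto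
  have "generate G {a} \<subseteq> H" using abel d(3) sub_carr by (auto simp: H_def)
  then have HA: "H = generate G {a}"
    using self_cent[OF cent(1)] d(2,3) by (auto simp: H_def)
  have sq: "y [^] (2::nat) = z" if y: "y \<in> carrier G" "y \<notin> generate G {a}" for y
  proof -
    have ysq: "y [^] (2::nat) \<in> generate G {a}"
      using cent(2)[of y y] y HA by (simp add: numeral_2_eq_2)
    have y1: "y \<noteq> \<one>" using y(2) generate.one by metis
    have c2: "y [^] (2::nat) \<in> carrier G" using y by simp
    obtain l where l: "ord (y [^] (2::nat)) = p ^ l" using ord_prime_power[OF c2] .
    have "l < 2"
    proof (rule ccontr)
      assume "\<not> l < 2"
      then have o4: "ord ((y [^] (2::nat)) [^] (p ^ (l - 2))) = 4"
        using ord_pow_prime_power[OF c2 l, of "l - 2"] p by simp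
      let ?w = "(y [^] (2::nat)) [^] (p ^ (l - 2))"
      have "?w \<in> generate G {y [^] (2::nat)}" using generate_singleton[OF c2] by auto
      then have wa: "?w \<in> generate G {a}" using generate_singleton_mono[OF a(1) ysq] by blast
      have "generate G {d} = generate G {?w}"
        by (rule generate_eq_if_same_ord[OF a(1) d(3) wa]) (simp only: d(2) o4)
      moreover have "d \<in> generate G {d}" using generate.incl[of d "{d}" G] by simp
      ultimately have "d \<in> generate G {?w}" by simp
      then obtain i :: nat where "d = ?w [^] i" using generate_singleton[of ?w] c2 by auto
      then have "d = y [^] (2 * p ^ (l - 2) * i)" using y by (simp add: nat_pow_pow)
      then have "y \<otimes> d = d \<otimes> y" using y nat_pow_comm[OF y(1), of 1] by simp
      then show False using y HA by (auto simp: H_def)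
    qed
    moreover have "l \<noteq> 0"
    proof
      assume "l = 0"
      then have "y [^] (2::nat) = \<one>" using l ord_eq_1[OF c2] by simp
      then have "ord y = p" using ord_prime_iff[OF y(1)] y1 p by simp
      then have "y \<in> generate G {z}" using unique z(1,2) y(1) p by simp
      then show False using generate_singleton_mono[OF a(1) z(3)] y(2) by blast
    qed
    ultimately have "l = 1" by linarith
    then have "ord (y [^] (2::nat)) = 2" using l p by simp
    then have "y [^] (2::nat) \<in> generate G {z}" "y [^] (2::nat) \<noteq> \<one>"
      using unique z(1,2) c2 p by auto
    then show ?thesis using involution_unique_in_generate[OF z(1,2)] by blast
  qed
  obtain x where x: "x \<in> carrier G" "x \<notin> generate G {a}" using nc sub_carr by blast
  have suba: "subgroup (generate G {a}) G" using a by (intro generate_is_subgroup) simp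
  have aa: "a \<in> generate G {a}" using generate.incl[of a "{a}" G] by simp
  have xa: "x \<otimes> a \<notin> generate G {a}"
  proof
    assume "x \<otimes> a \<in> generate G {a}"
    then have "(x \<otimes> a) \<otimes> inv a \<in> generate G {a}"
      using aa subgroup.m_closed[OF suba] subgroup.m_inv_closed[OF suba] by blast
    then show False using x a(1) by (simp add: m_assoc)
  qed
  have "(x \<otimes> a) [^] (2::nat) = x [^] (2::nat)" using sq xa x a(1) by simp
  then have "x \<otimes> (a \<otimes> (x \<otimes> a)) = x \<otimes> x" using x a(1) by (simp add: numeral_2_eq_2 m_assoc)
  then have "a \<otimes> (x \<otimes> a) = x" using x a(1) by simp
  then have "inv x \<otimes> (a \<otimes> (x \<otimes> a)) = \<one>" using x by simp
  then have "(inv x \<otimes> a \<otimes> x) \<otimes> a = \<one>" using x a(1) by (simp add: m_assoc)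
  then have rel: "inv x \<otimes> a \<otimes> x = inv a" using x a(1) inv_equality[of "inv x \<otimes> a \<otimes> x" a] by simp
  have xi: "inv x \<notin> generate G {a}"
  proof
    assume "inv x \<in> generate G {a}"
    then have "inv (inv x) \<in> generate G {a}" by (rule subgroup.m_inv_closed[OF suba])
    then show False using x by simp
  qed
  have "g \<in> generate G {a} \<or> g \<otimes> inv x \<in> generate G {a}" if "g \<in> carrier G" for g
    using cent(2)[of g "inv x"] that x xi HA by auto
  then show ?thesis
    using k2 k a(1) x sq[OF x] rel by (intro exI[of _ k] exI[of _ a] exI[of _ x]) (simp add: z_def)
qed

end

section \<open>Homomorphisms out of a presented group\<close>

definition eval_letter :: "('a, 'm) monoid_scheme \<Rightarrow> ('g \<Rightarrow> 'a) \<Rightarrow> 'g \<times> bool \<Rightarrow> 'a" where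
  "eval_letter H \<phi> l = (if snd l then \<phi> (fst l) else inv\<^bsub>H\<^esub> \<phi> (fst l))"

definition eval_word :: "('a, 'm) monoid_scheme \<Rightarrow> ('g \<Rightarrow> 'a) \<Rightarrow> 'g group_word \<Rightarrow> 'a" where
  "eval_word H \<phi> w = foldr (\<lambda>l y. eval_letter H \<phi> l \<otimes>\<^bsub>H\<^esub> y) w \<one>\<^bsub>H\<^esub>"

lemma eval_word_Nil [simp]: "eval_word H \<phi> [] = \<one>\<^bsub>H\<^esub>"
  and eval_word_Cons [simp]: "eval_word H \<phi> (l # w) = eval_letter H \<phi> l \<otimes>\<^bsub>H\<^esub> eval_word H \<phi> w"
  by (simp_all add: eval_word_def)

abbreviation word_class :: "('g group_word \<times> 'g group_word) set \<Rightarrow> 'g group_word \<Rightarrow> 'g group_word set" where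
  "word_class R w \<equiv> word_rel R `` {w}"

lemma word_class_eq_iff: "word_class R u = word_class R v \<longleftrightarrow> word_eq R u v"
  using eq_equiv_class_iff[OF equiv_word_rel, of u v] by (simp add: word_rel_def)

lemma word_class_in_presented_group: "word_class R w \<in> carrier (presented_group R)"
  by (auto simp: presented_group_def quotient_def)

lemma presented_group_cases:
  assumes "A \<in> carrier (presented_group R)"
  obtains w where "A = word_class R w"
  using assms by (auto simp: presented_group_def quotient_def)

lemma one_presented_group: "\<one>\<^bsub>presented_group R\<^esub> = word_class R []"
  by (simp add: presented_group_def)

lemma word_class_replicate:
  "word_class R (replicate k (g, True)) = word_class R [(g, True)] [^]\<^bsub>presented_group R\<^esub> k"
proof -
  interpret P: group "presented_group R" by (rule group_presented_group)
  show ?thesis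
  proof (induction k)
    case (Suc k)
    have "replicate (Suc k) (g, True) = replicate k (g, True) @ [(g, True)]"
      by (simp add: replicate_append_same)
    then show ?case using Suc by (simp only: mult_presented_group[symmetric] P.nat_pow_Suc)
  qed (simp add: one_presented_group)
qed

lemma word_class_inverse_letter:
  "word_class R [(g, False)] = inv\<^bsub>presented_group R\<^esub> word_class R [(g, True)]"
proof -
  interpret P: group "presented_group R" by (rule group_presented_group)
  have "word_eq R [(g, False), (g, True)] []"
    using word_eq.cancel[of R "[]" g False "[]"] by simp
  then have "word_class R [(g, False)] \<otimes>\<^bsub>presented_group R\<^esub> word_class R [(g, True)] = \<one>\<^bsub>presented_group R\<^esub>"
    by (simp add: mult_presented_group one_presented_group word_class_eq_iff)
  then show ?thesis using P.inv_equality word_class_in_presented_group by metis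
qed

context group
begin

lemma eval_letter_closed: "range \<phi> \<subseteq> carrier G \<Longrightarrow> eval_letter G \<phi> l \<in> carrier G"
  by (auto simp: eval_letter_def image_subset_iff)

lemma eval_word_closed: "range \<phi> \<subseteq> carrier G \<Longrightarrow> eval_word G \<phi> w \<in> carrier G"
  by (induction w) (auto simp: eval_letter_closed)

lemma eval_word_append:
  "range \<phi> \<subseteq> carrier G \<Longrightarrow> eval_word G \<phi> (u @ v) = eval_word G \<phi> u \<otimes> eval_word G \<phi> v"
  by (induction u) (auto simp: eval_letter_closed eval_word_closed m_assoc)

lemma eval_word_replicate:
  "range \<phi> \<subseteq> carrier G \<Longrightarrow> eval_word G \<phi> (replicate k (g, True)) = \<phi> g [^] k"
proof (induction k)
  case (Suc k)
  then have "\<phi> g \<in> carrier G" by blast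
  then show ?case using Suc by (simp only: replicate_Suc eval_word_Cons nat_pow_Suc2) (simp add: eval_letter_def)
qed simp

lemma eval_word_cong:
  assumes "word_eq R u v" "range \<phi> \<subseteq> carrier G"
    and rel: "\<And>l r. (l, r) \<in> R \<Longrightarrow> eval_word G \<phi> l = eval_word G \<phi> r"
  shows "eval_word G \<phi> u = eval_word G \<phi> v"
  using assms(1)
proof induction
  case (cancel u g s v)
  have "\<phi> g \<in> carrier G" using assms(2) by blast
  then have "eval_letter G \<phi> (g, s) \<otimes> eval_letter G \<phi> (g, \<not> s) = \<one>"
    by (cases s) (simp_all add: eval_letter_def)
  then have "eval_word G \<phi> [(g, s), (g, \<not> s)] = \<one>"
    using assms(2) by (simp add: eval_letter_closed)
  then show ?case
    using assms(2) by (simp only: eval_word_append l_one eval_word_closed)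
next
  case (rel l r u v)
  then show ?case using assms(2,3) by (simp add: eval_word_append)
qed auto

lemma presented_group_hom:
  assumes "range \<phi> \<subseteq> carrier G" "\<And>l r. (l, r) \<in> R \<Longrightarrow> eval_word G \<phi> l = eval_word G \<phi> r"
  obtains h where "h \<in> hom (presented_group R) G" "\<And>w. h (word_class R w) = eval_word G \<phi> w"
proof -
  define h where "h A = eval_word G \<phi> (SOME w. w \<in> A)" for A
  have h: "h (word_class R w) = eval_word G \<phi> w" for w
  proof -
    have "w \<in> word_class R w" by (simp add: word_rel_def word_eq.refl)
    then have "(SOME v. v \<in> word_class R w) \<in> word_class R w" by (rule someI)
    then have "word_eq R w (SOME v. v \<in> word_class R w)" by (simp add: word_rel_def)
    then show ?thesis using eval_word_cong[OF _ assms] by (simp add: h_def)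
  qed
  have "h \<in> hom (presented_group R) G"
  proof (rule homI)
    fix A assume "A \<in> carrier (presented_group R)"
    then obtain u where u: "A = word_class R u" by (rule presented_group_cases)
    show "h A \<in> carrier G" unfolding u h by (rule eval_word_closed[OF assms(1)])
    fix B assume "B \<in> carrier (presented_group R)"
    then obtain v where v: "B = word_class R v" by (rule presented_group_cases)
    show "h (A \<otimes>\<^bsub>presented_group R\<^esub> B) = h A \<otimes> h B"
      unfolding u v mult_presented_group h by (rule eval_word_append[OF assms(1)])
  qed
  then show ?thesis using h that by blast
qed

section \<open>Generalized quaternion groups\<close>

lemma quaternion_commutation:
  assumes X: "X \<in> carrier G" and Y: "Y \<in> carrier G" and N: "X [^] (N::nat) = \<one>" "N > 0"
    and conj: "inv Y \<otimes> X \<otimes> Y = inv X"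
  shows "inv X = X [^] (N - 1)" "Y \<otimes> X = X [^] (N - 1) \<otimes> Y"
proof -
  have "X [^] (N - 1) \<otimes> X = X [^] N" using N(2) nat_pow_Suc[of X "N - 1"] by simp
  then show inv: "inv X = X [^] (N - 1)" using N(1) X inv_equality by simp
  have "X \<otimes> Y = Y \<otimes> (inv Y \<otimes> X \<otimes> Y)" using X Y by (simp add: m_assoc[symmetric])
  then have XY: "X \<otimes> Y = Y \<otimes> inv X" using conj by simp
  have "Y \<otimes> X = inv X \<otimes> (X \<otimes> Y) \<otimes> X" using X Y by (simp add: m_assoc[symmetric])
  also have "\<dots> = inv X \<otimes> Y" unfolding XY using X Y by (simp add: m_assoc)
  finally show "Y \<otimes> X = X [^] (N - 1) \<otimes> Y" by (simp add: inv)
qed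

definition quaternion_form :: "'a \<Rightarrow> 'a \<Rightarrow> 'a \<Rightarrow> bool" where
  "quaternion_form X Y g \<longleftrightarrow> (\<exists>i::nat. g = X [^] i \<or> g = X [^] i \<otimes> Y)"

text \<open>
  The relations move \<open>Y\<close> to the right past powers of \<open>X\<close>. As the inverses of the generators are powers
  of them, every word in the generators is brought into this form.
\<close>

lemma quaternion_form_mult:
  assumes X: "X \<in> carrier G" and Y: "Y \<in> carrier G" and N: "X [^] (N::nat) = \<one>" "N > 0"
    and sq: "X [^] (M::nat) = Y [^] (2::nat)" and conj: "inv Y \<otimes> X \<otimes> Y = inv X"
    and g: "quaternion_form X Y g" and h: "h \<in> {X, Y, inv X, inv Y}"
  shows "quaternion_form X Y (g \<otimes> h)"
proof -
  note comm = quaternion_commutation[OF X Y N conj]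
  have gX: "quaternion_form X Y (g \<otimes> X)" if "quaternion_form X Y g" for g
  proof -
    from that obtain i :: nat where "g = X [^] i \<or> g = X [^] i \<otimes> Y" by (auto simp: quaternion_form_def)
    then have "g \<otimes> X = X [^] Suc i \<or> g \<otimes> X = X [^] (i + (N - 1)) \<otimes> Y"
    proof
      assume "g = X [^] i \<otimes> Y"
      then have "g \<otimes> X = X [^] i \<otimes> (Y \<otimes> X)" using X Y by (simp add: m_assoc)
      also have "\<dots> = X [^] (i + (N - 1)) \<otimes> Y"
        unfolding comm(2) using X Y by (simp add: m_assoc[symmetric] nat_pow_mult)
      finally show ?thesis ..
    qed simp
    then show ?thesis unfolding quaternion_form_def by blast
  qed
  have gY: "quaternion_form X Y (g \<otimes> Y)" if "quaternion_form X Y g" for g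
  proof -
    from that obtain i :: nat where "g = X [^] i \<or> g = X [^] i \<otimes> Y" by (auto simp: quaternion_form_def)
    then have "g \<otimes> Y = X [^] i \<otimes> Y \<or> g \<otimes> Y = X [^] (i + M)"
    proof
      assume "g = X [^] i \<otimes> Y"
      then have "g \<otimes> Y = X [^] i \<otimes> X [^] M" using X Y sq by (simp add: m_assoc numeral_2_eq_2)
      then show ?thesis using X by (simp add: nat_pow_mult)
    qed simp
    then show ?thesis unfolding quaternion_form_def by blast
  qed
  have pow: "quaternion_form X Y (g \<otimes> u [^] (k::nat))"
    if "u \<in> carrier G" "\<And>g. quaternion_form X Y g \<Longrightarrow> quaternion_form X Y (g \<otimes> u)" for u k
  proof (induction k)
    case 0
    then show ?case using g X Y by (auto simp: quaternion_form_def)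
  next
    case (Suc k)
    have "g \<in> carrier G" using g X Y by (auto simp: quaternion_form_def)
    then show ?case using that(2)[OF Suc] that(1) by (simp add: m_assoc)
  qed
  have "Y [^] (2 * N) = X [^] (M * N)" using X Y sq by (simp add: nat_pow_pow[symmetric])
  also have "\<dots> = (X [^] N) [^] M" using X by (simp add: nat_pow_pow mult.commute)
  also have "\<dots> = \<one>" using N by simp
  finally have "Y [^] (2 * N - 1) \<otimes> Y = \<one>" using nat_pow_Suc[of Y "2 * N - 1"] N(2) by simp
  then have "inv Y = Y [^] (2 * N - 1)" using Y inv_equality by simp
  then show ?thesis using h gX[OF g] gY[OF g] pow[OF X gX] pow[OF Y gY] comm(1) by auto
qed

text \<open>
  Let \<open>z = Y [^] 2\<close>. All elements \<open>X [^] i \<otimes> Y\<close> have the square \<open>z\<close>. For \<open>i = 2 ^ v * m\<close> with odd \<open>m\<close> and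
  \<open>v < e\<close>, raising \<open>X [^] i\<close> to the power \<open>2 ^ (e - 1 - v)\<close> gives \<open>z [^] m = z\<close>.
\<close>

lemma quaternion_form_comparable:
  assumes X: "X \<in> carrier G" and Y: "Y \<in> carrier G" and N: "X [^] ((2::nat) ^ e) = \<one>" "e \<ge> 1"
    and sq: "X [^] ((2::nat) ^ (e - 1)) = Y [^] (2::nat)" and conj: "inv Y \<otimes> X \<otimes> Y = inv X"
    and g: "quaternion_form X Y g" "g \<noteq> \<one>"
  shows "comparable G (X [^] ((2::nat) ^ (e - 1))) g"
proof -
  let ?z = "X [^] ((2::nat) ^ (e - 1))"
  have e: "(2::nat) ^ e = 2 * 2 ^ (e - 1)" using N(2) by (simp add: power_eq_if)
  obtain i :: nat where "g = X [^] i \<or> g = X [^] i \<otimes> Y" using g by (auto simp: quaternion_form_def)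
  then have "\<exists>n::nat. ?z = g [^] n"
  proof
    assume gi: "g = X [^] i"
    have "i \<noteq> 0" using gi g(2) by (cases i) auto
    obtain m where m: "i = 2 ^ multiplicity 2 i * m" "\<not> 2 dvd m"
      using \<open>i \<noteq> 0\<close> multiplicity_decompose'[of i 2] by auto
    define v where "v = multiplicity 2 i"
    have "v < e"
    proof (rule ccontr)
      assume "\<not> v < e"
      then have "2 ^ e dvd i" using m(1) by (metis dvd_triv_left dvd_trans le_imp_power_dvd not_less v_def)
      then obtain q where "i = 2 ^ e * q" by blast
      then have "g = \<one>" using gi X N(1) by (simp add: nat_pow_pow[symmetric])
      then show False using g(2) by simp
    qed
    obtain q where q: "m = 2 * q + 1" using m(2) by (metis oddE)
    have "i * 2 ^ (e - 1 - v) = 2 ^ (v + (e - 1 - v)) * m"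
      using m(1) by (simp add: v_def power_add)
    also have "\<dots> = 2 ^ (e - 1) + 2 ^ e * q" using \<open>v < e\<close> e q by (simp add: algebra_simps)
    finally have "g [^] ((2::nat) ^ (e - 1 - v)) = ?z \<otimes> (X [^] ((2::nat) ^ e)) [^] q"
      using gi X by (simp add: nat_pow_pow nat_pow_mult)
    then have "?z = g [^] ((2::nat) ^ (e - 1 - v))" using N(1) X by simp
    then show ?thesis by blast
  next
    assume gi: "g = X [^] i \<otimes> Y"
    have "g [^] (2::nat) = X [^] (i * (\<Sum>j<2. (2 ^ e - 1) ^ j)) \<otimes> Y [^] (2::nat)"
      unfolding gi by (rule twisted_product_pow[OF X Y quaternion_commutation(2)[OF X Y N(1) _ conj]]) simp
    also have "(\<Sum>j<2. (2 ^ e - 1) ^ j) = (2::nat) ^ e"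
      by (simp add: numeral_2_eq_2)
    also have "X [^] (i * (2::nat) ^ e) = \<one>"
      using X N(1) by (simp add: mult.commute[of i] nat_pow_pow[symmetric])
    finally have "g [^] (2::nat) = ?z" using sq Y by simp
    then show ?thesis by metis
  qed
  then show ?thesis by (auto simp: comparable_def)
qed

end

abbreviation quaternion_group :: "nat \<Rightarrow> quaternion_generator group_word set monoid" where
  "quaternion_group e \<equiv> presented_group (quaternion_relations e)"

abbreviation quaternion_x :: "nat \<Rightarrow> quaternion_generator group_word set" where
  "quaternion_x e \<equiv> word_class (quaternion_relations e) [(gen_x, True)]"

abbreviation quaternion_y :: "nat \<Rightarrow> quaternion_generator group_word set" where
  "quaternion_y e \<equiv> word_class (quaternion_relations e) [(gen_y, True)]"

lemma quaternion_group_relations: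
  fixes e :: nat
  defines "P \<equiv> quaternion_group e" and "X \<equiv> quaternion_x e" and "Y \<equiv> quaternion_y e"
  shows "X [^]\<^bsub>P\<^esub> ((2::nat) ^ e) = \<one>\<^bsub>P\<^esub>"
    and "X [^]\<^bsub>P\<^esub> ((2::nat) ^ (e - 1)) = Y [^]\<^bsub>P\<^esub> (2::nat)"
    and "inv\<^bsub>P\<^esub> Y \<otimes>\<^bsub>P\<^esub> X \<otimes>\<^bsub>P\<^esub> Y = inv\<^bsub>P\<^esub> X"
proof -
  let ?R = "quaternion_relations e"
  have rel: "word_class ?R l = word_class ?R r" if "(l, r) \<in> ?R" for l r
    using word_eq.rel[OF that, of "[]" "[]"] by (simp add: word_class_eq_iff)
  show "X [^]\<^bsub>P\<^esub> ((2::nat) ^ e) = \<one>\<^bsub>P\<^esub>"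
    unfolding P_def X_def word_class_replicate[symmetric] one_presented_group
    by (rule rel) (simp add: quaternion_relations_def)
  show "X [^]\<^bsub>P\<^esub> ((2::nat) ^ (e - 1)) = Y [^]\<^bsub>P\<^esub> (2::nat)"
    unfolding P_def X_def Y_def word_class_replicate[symmetric]
    by (rule rel) (simp add: quaternion_relations_def)
  show "inv\<^bsub>P\<^esub> Y \<otimes>\<^bsub>P\<^esub> X \<otimes>\<^bsub>P\<^esub> Y = inv\<^bsub>P\<^esub> X"
    unfolding P_def X_def Y_def word_class_inverse_letter[symmetric] mult_presented_group
    by (rule rel) (simp add: quaternion_relations_def)
qed

lemma quaternion_group_form:
  assumes "A \<in> carrier (quaternion_group e)"
  shows "group.quaternion_form (quaternion_group e) (quaternion_x e) (quaternion_y e) A"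
proof -
  let ?R = "quaternion_relations e"
  interpret P: group "quaternion_group e" by (rule group_presented_group)
  obtain w where A: "A = word_class ?R w" using assms by (rule presented_group_cases)
  show ?thesis unfolding A
  proof (induction w rule: rev_induct)
    case Nil
    have "word_class ?R [] = quaternion_x e [^]\<^bsub>quaternion_group e\<^esub> (0::nat)"
      by (simp add: one_presented_group)
    then show ?case unfolding P.quaternion_form_def by blast
  next
    case (snoc l w)
    obtain g s where l: "l = (g, s)" by fastforce
    have lw: "word_class ?R [l] \<in> {quaternion_x e, quaternion_y e,
        inv\<^bsub>quaternion_group e\<^esub> quaternion_x e, inv\<^bsub>quaternion_group e\<^esub> quaternion_y e}"
      unfolding l by (cases g; cases s) (simp_all add: word_class_inverse_letter)
    have "P.quaternion_form (quaternion_x e) (quaternion_y e)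
        (word_class ?R w \<otimes>\<^bsub>quaternion_group e\<^esub> word_class ?R [l])"
      by (rule P.quaternion_form_mult[OF word_class_in_presented_group word_class_in_presented_group
          quaternion_group_relations(1) _ quaternion_group_relations(2,3) snoc lw]) simp
    then show ?case by (simp only: mult_presented_group)
  qed
qed

text \<open>
  A pair \<open>(a, b)\<close> stands for the quaternion \<open>a + b j\<close>. The generalized quaternion groups are realised
  in this group by a root of unity and \<open>j\<close>.
\<close>

definition unit_quaternions :: "(complex \<times> complex) monoid" where
  "unit_quaternions =
     \<lparr> carrier = {(a, b). a * cnj a + b * cnj b = 1},
       monoid.mult = (\<lambda>(a, b) (c, d). (a * c - b * cnj d, a * d + b * cnj c)),
       one = (1, 0) \<rparr>"

lemma unit_quaternions_simps:
  "(a, b) \<in> carrier unit_quaternions \<longleftrightarrow> a * cnj a + b * cnj b = 1"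
  "(a, b) \<otimes>\<^bsub>unit_quaternions\<^esub> (c, d) = (a * c - b * cnj d, a * d + b * cnj c)"
  "\<one>\<^bsub>unit_quaternions\<^esub> = (1, 0)"
  by (simp_all add: unit_quaternions_def)

lemma group_unit_quaternions: "group unit_quaternions"
proof (rule groupI)
  fix u v assume "u \<in> carrier unit_quaternions" "v \<in> carrier unit_quaternions"
  moreover obtain a b c d where uv: "u = (a, b)" "v = (c, d)" by fastforce
  ultimately have n: "a * cnj a + b * cnj b = 1" "c * cnj c + d * cnj d = 1"
    by (simp_all add: unit_quaternions_simps)
  have "(a * c - b * cnj d) * cnj (a * c - b * cnj d) + (a * d + b * cnj c) * cnj (a * d + b * cnj c)
    = (a * cnj a + b * cnj b) * (c * cnj c + d * cnj d)"
    by (simp add: algebra_simps)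
  also have "\<dots> = 1" by (simp add: n)
  finally show "u \<otimes>\<^bsub>unit_quaternions\<^esub> v \<in> carrier unit_quaternions"
    by (simp only: uv unit_quaternions_simps)
next
  fix u assume u: "u \<in> carrier unit_quaternions"
  moreover obtain a b where ab: "u = (a, b)" by fastforce
  ultimately have n: "a * cnj a + b * cnj b = 1" by (simp add: unit_quaternions_simps)
  show "\<one>\<^bsub>unit_quaternions\<^esub> \<otimes>\<^bsub>unit_quaternions\<^esub> u = u"
    by (simp add: ab unit_quaternions_simps)
  have "(cnj a, - b) \<in> carrier unit_quaternions"
    using n by (simp add: unit_quaternions_simps mult.commute)
  moreover have "(cnj a, - b) \<otimes>\<^bsub>unit_quaternions\<^esub> u = \<one>\<^bsub>unit_quaternions\<^esub>"
    using n by (simp add: ab unit_quaternions_simps mult.commute)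
  ultimately show "\<exists>v \<in> carrier unit_quaternions. v \<otimes>\<^bsub>unit_quaternions\<^esub> u = \<one>\<^bsub>unit_quaternions\<^esub>"
    by blast
next
  fix u v w assume "u \<in> carrier unit_quaternions" "v \<in> carrier unit_quaternions" "w \<in> carrier unit_quaternions"
  obtain a b c d x y where "u = (a, b)" "v = (c, d)" "w = (x, y)" by (metis surj_pair)
  then show "u \<otimes>\<^bsub>unit_quaternions\<^esub> v \<otimes>\<^bsub>unit_quaternions\<^esub> w = u \<otimes>\<^bsub>unit_quaternions\<^esub> (v \<otimes>\<^bsub>unit_quaternions\<^esub> w)"
    by (simp add: unit_quaternions_simps algebra_simps)
qed (simp add: unit_quaternions_simps)

text \<open>
  A presentation may collapse, so a witness is needed: in the unit quaternions the element is \<open>-1\<close>.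
\<close>

lemma quaternion_group_involution_nontrivial:
  assumes "e \<ge> 1"
  shows "quaternion_x e [^]\<^bsub>quaternion_group e\<^esub> ((2::nat) ^ (e - 1)) \<noteq> \<one>\<^bsub>quaternion_group e\<^esub>"
proof -
  let ?Q = "unit_quaternions"
  let ?R = "quaternion_relations e"
  interpret Q: group ?Q by (rule group_unit_quaternions)
  define \<zeta> where "\<zeta> = cis (pi / 2 ^ (e - 1))"
  have norm: "\<zeta> * cnj \<zeta> = 1" by (simp add: \<zeta>_def cis_cnj cis_mult)
  have half: "\<zeta> ^ (2 ^ (e - 1)) = - 1" by (simp add: \<zeta>_def DeMoivre)
  have full: "\<zeta> ^ (2 ^ e) = 1"
    using half assms by (simp add: power_eq_if[of 2 e] power_mult mult.commute[of 2])
  define \<phi> where "\<phi> g = (case g of gen_x \<Rightarrow> (\<zeta>, 0 :: complex) | gen_y \<Rightarrow> (0, 1))" for g :: quaternion_generator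
  have \<phi>: "range \<phi> \<subseteq> carrier ?Q"
    using norm by (auto simp: \<phi>_def unit_quaternions_simps split: quaternion_generator.splits)
  have pow: "(\<zeta>, 0) [^]\<^bsub>?Q\<^esub> k = (\<zeta> ^ k, 0)" for k :: nat
    by (induction k) (simp_all add: unit_quaternions_simps mult.commute)
  have inv_x: "inv\<^bsub>?Q\<^esub> (\<zeta>, 0) = (cnj \<zeta>, 0)"
    using norm by (intro Q.inv_equality) (simp_all add: unit_quaternions_simps mult.commute)
  have inv_y: "inv\<^bsub>?Q\<^esub> (0, 1) = (0, - 1)"
    by (intro Q.inv_equality) (simp_all add: unit_quaternions_simps)
  have rel: "eval_word ?Q \<phi> l = eval_word ?Q \<phi> r" if "(l, r) \<in> ?R" for l r
  proof -
    from that consider "l = replicate (2 ^ e) (gen_x, True)" "r = []"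
      | "l = replicate (2 ^ (e - 1)) (gen_x, True)" "r = replicate 2 (gen_y, True)"
      | "l = [(gen_y, False), (gen_x, True), (gen_y, True)]" "r = [(gen_x, False)]"
      by (auto simp: quaternion_relations_def)
    then show ?thesis
    proof cases
      case 1
      then show ?thesis
        using Q.eval_word_replicate[OF \<phi>] full by (simp add: \<phi>_def pow unit_quaternions_simps)
    next
      case 2
      have "(0, 1) [^]\<^bsub>?Q\<^esub> (2::nat) = (- 1, 0)"
        by (simp add: numeral_2_eq_2 unit_quaternions_simps)
      then show ?thesis
        unfolding 2 Q.eval_word_replicate[OF \<phi>] using half by (simp add: \<phi>_def pow)
    next
      case 3
      then show ?thesis
        by (simp add: eval_letter_def \<phi>_def inv_x inv_y unit_quaternions_simps)
    qed
  qed
  obtain h where h: "\<And>w. h (word_class ?R w) = eval_word ?Q \<phi> w"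
    using Q.presented_group_hom[OF \<phi> rel] by blast
  have "eval_word ?Q \<phi> (replicate (2 ^ (e - 1)) (gen_x, True)) = (- 1, 0)"
    unfolding Q.eval_word_replicate[OF \<phi>] using half by (simp add: \<phi>_def pow)
  moreover have "eval_word ?Q \<phi> [] = (1, 0)" by (simp add: unit_quaternions_simps)
  ultimately have "word_class ?R (replicate (2 ^ (e - 1)) (gen_x, True)) \<noteq> word_class ?R []"
    using h by (metis one_neq_neg_one prod.inject)
  then show ?thesis by (simp add: word_class_replicate one_presented_group)
qed

lemma generalized_quaternion_dominating:
  assumes "group G" "generalized_quaternion G"
  shows "\<exists>z \<in> carrier G. z \<noteq> \<one>\<^bsub>G\<^esub> \<and> (\<forall>g \<in> carrier G. g \<noteq> \<one>\<^bsub>G\<^esub> \<longrightarrow> comparable G z g)"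
proof -
  interpret group G by fact
  obtain e where e: "e \<ge> 2" "G \<cong> quaternion_group e" using assms(2) by (auto simp: generalized_quaternion_def)
  let ?P = "quaternion_group e"
  interpret P: group ?P by (rule group_presented_group)
  have "?P \<cong> G" using iso_sym[OF e(2)] .
  then obtain f where f: "f \<in> iso ?P G" by (auto simp: is_iso_def)
  interpret f: group_hom ?P G f
    using f by (intro group_hom.intro group_hom_axioms.intro P.is_group is_group) (simp add: iso_def)
  have bij: "bij_betw f (carrier ?P) (carrier G)" using f by (simp add: iso_def)
  let ?z = "quaternion_x e [^]\<^bsub>?P\<^esub> ((2::nat) ^ (e - 1))"
  have z: "?z \<in> carrier ?P" "?z \<noteq> \<one>\<^bsub>?P\<^esub>"
    using quaternion_group_involution_nontrivial e(1) word_class_in_presented_group by auto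
  have one_iff: "f u = \<one>\<^bsub>G\<^esub> \<longleftrightarrow> u = \<one>\<^bsub>?P\<^esub>" if "u \<in> carrier ?P" for u
    using bij that f.hom_one P.one_closed by (metis bij_betw_imp_inj_on inj_onD)
  have "comparable G (f ?z) g" if g: "g \<in> carrier G" "g \<noteq> \<one>\<^bsub>G\<^esub>" for g
  proof -
    obtain u where u: "u \<in> carrier ?P" "g = f u" using bij g(1) by (auto simp: bij_betw_def)
    have "u \<noteq> \<one>\<^bsub>?P\<^esub>" using u g(2) f.hom_one by metis
    then have "comparable ?P ?z u"
      using P.quaternion_form_comparable[OF word_class_in_presented_group word_class_in_presented_group
          quaternion_group_relations(1) _ quaternion_group_relations(2,3) quaternion_group_form[OF u(1)]] e(1)
      by simp
    then show ?thesis
      using f.hom_nat_pow[OF z(1)] f.hom_nat_pow[OF u(1)] unfolding comparable_def u(2) by metis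
  qed
  then show ?thesis using f.hom_closed[OF z(1)] one_iff[OF z(1)] z(2) by blast
qed

text \<open>
  The homomorphism from the presented group is onto by the assumption on the elements of \<open>G\<close>. It is
  injective because the normal form in the presented group uses the exponent of \<open>X\<close> only modulo
  \<open>2 ^ e\<close>, the order of \<open>a\<close>, and \<open>x\<close> is not a power of \<open>a\<close>.
\<close>

lemma generalized_quaternionI:
  assumes "group G" and a: "a \<in> carrier G" and x: "x \<in> carrier G"
    and ord: "group.ord G a = 2 ^ e" "e \<ge> 2"
    and sq: "x [^]\<^bsub>G\<^esub> (2::nat) = a [^]\<^bsub>G\<^esub> ((2::nat) ^ (e - 1))"
    and conj: "inv\<^bsub>G\<^esub> x \<otimes>\<^bsub>G\<^esub> a \<otimes>\<^bsub>G\<^esub> x = inv\<^bsub>G\<^esub> a"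
    and notin: "\<And>i::nat. x \<noteq> a [^]\<^bsub>G\<^esub> i"
    and form: "\<And>g. g \<in> carrier G \<Longrightarrow> group.quaternion_form G a x g"
  shows "generalized_quaternion G"
proof -
  interpret group G by fact
  let ?R = "quaternion_relations e"
  let ?P = "quaternion_group e"
  interpret P: group ?P by (rule group_presented_group)
  define \<phi> where "\<phi> g = (case g of gen_x \<Rightarrow> a | gen_y \<Rightarrow> x)" for g :: quaternion_generator
  have \<phi>: "range \<phi> \<subseteq> carrier G" using a x by (auto simp: \<phi>_def split: quaternion_generator.splits)
  have aN: "a [^]\<^bsub>G\<^esub> ((2::nat) ^ e) = \<one>\<^bsub>G\<^esub>" using pow_eq_id[OF a] ord(1) by simp
  have rel: "eval_word G \<phi> l = eval_word G \<phi> r" if "(l, r) \<in> ?R" for l r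
  proof -
    from that consider "l = replicate (2 ^ e) (gen_x, True)" "r = []"
      | "l = replicate (2 ^ (e - 1)) (gen_x, True)" "r = replicate 2 (gen_y, True)"
      | "l = [(gen_y, False), (gen_x, True), (gen_y, True)]" "r = [(gen_x, False)]"
      by (auto simp: quaternion_relations_def)
    then show ?thesis
    proof cases
      case 1
      then show ?thesis using eval_word_replicate[OF \<phi>] aN by (simp add: \<phi>_def)
    next
      case 2
      then show ?thesis using eval_word_replicate[OF \<phi>] sq by (simp only:) (simp add: \<phi>_def)
    next
      case 3
      then show ?thesis using a x conj by (simp add: eval_letter_def \<phi>_def m_assoc)
    qed
  qed
  obtain h where h: "h \<in> hom ?P G" "\<And>w. h (word_class ?R w) = eval_word G \<phi> w"
    using presented_group_hom[OF \<phi> rel] by blast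
  interpret h: group_hom ?P G h
    by (intro group_hom.intro group_hom_axioms.intro P.is_group is_group h(1))
  have hx: "h (quaternion_x e) = a" using a h(2)[of "[(gen_x, True)]"] by (simp add: eval_letter_def \<phi>_def)
  have hy: "h (quaternion_y e) = x" using x h(2)[of "[(gen_y, True)]"] by (simp add: eval_letter_def \<phi>_def)
  note XY = word_class_in_presented_group[of ?R "[(gen_x, True)]"] word_class_in_presented_group[of ?R "[(gen_y, True)]"]
  have hX: "h (quaternion_x e [^]\<^bsub>?P\<^esub> i) = a [^]\<^bsub>G\<^esub> i" for i :: nat
    using h.hom_nat_pow[OF XY(1)] hx by simp
  have hXY: "h (quaternion_x e [^]\<^bsub>?P\<^esub> i \<otimes>\<^bsub>?P\<^esub> quaternion_y e) = a [^]\<^bsub>G\<^esub> i \<otimes>\<^bsub>G\<^esub> x" for i :: nat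
    using h.hom_mult[OF P.nat_pow_closed[OF XY(1)] XY(2)] hX hy by simp
  have "h \<in> iso ?P G"
    unfolding h.iso_iff
  proof (intro conjI ballI impI subsetI)
    fix g assume "g \<in> carrier G"
    then obtain i :: nat where "g = a [^]\<^bsub>G\<^esub> i \<or> g = a [^]\<^bsub>G\<^esub> i \<otimes>\<^bsub>G\<^esub> x"
      using form by (auto simp: quaternion_form_def)
    then show "g \<in> h ` carrier ?P"
      using hX[of i] hXY[of i] XY by (metis P.m_closed P.nat_pow_closed imageI)
  next
    fix A assume A: "A \<in> carrier ?P" "h A = \<one>\<^bsub>G\<^esub>"
    obtain i :: nat where "A = quaternion_x e [^]\<^bsub>?P\<^esub> i \<or> A = quaternion_x e [^]\<^bsub>?P\<^esub> i \<otimes>\<^bsub>?P\<^esub> quaternion_y e"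
      using quaternion_group_form[OF A(1)] by (auto simp: P.quaternion_form_def)
    then show "A = \<one>\<^bsub>?P\<^esub>"
    proof
      assume Ai: "A = quaternion_x e [^]\<^bsub>?P\<^esub> i"
      then have "a [^]\<^bsub>G\<^esub> i = \<one>\<^bsub>G\<^esub>" using A(2) hX by simp
      then have "2 ^ e dvd i" using pow_eq_id[OF a] ord(1) by simp
      then obtain q where "i = 2 ^ e * q" by blast
      then show ?thesis
        using Ai quaternion_group_relations(1)[of e] P.nat_pow_pow[OF XY(1), of "2 ^ e" q] by simp
    next
      assume "A = quaternion_x e [^]\<^bsub>?P\<^esub> i \<otimes>\<^bsub>?P\<^esub> quaternion_y e"
      then have "a [^]\<^bsub>G\<^esub> i \<otimes>\<^bsub>G\<^esub> x = \<one>\<^bsub>G\<^esub>" using A(2) hXY by simp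
      moreover have "a [^]\<^bsub>G\<^esub> i \<otimes>\<^bsub>G\<^esub> a [^]\<^bsub>G\<^esub> (i * (2 ^ e - 1)) = \<one>\<^bsub>G\<^esub>"
      proof -
        have "i + i * (2 ^ e - 1) = 2 ^ e * i" by (cases "(2::nat) ^ e") (simp_all add: algebra_simps)
        then have "a [^]\<^bsub>G\<^esub> i \<otimes>\<^bsub>G\<^esub> a [^]\<^bsub>G\<^esub> (i * (2 ^ e - 1)) = a [^]\<^bsub>G\<^esub> (2 ^ e * i)"
          by (simp only: nat_pow_mult[OF a])
        also have "\<dots> = \<one>\<^bsub>G\<^esub>" using a aN by (simp add: nat_pow_pow[symmetric])
        finally show ?thesis .
      qed
      ultimately have "a [^]\<^bsub>G\<^esub> i \<otimes>\<^bsub>G\<^esub> x = a [^]\<^bsub>G\<^esub> i \<otimes>\<^bsub>G\<^esub> a [^]\<^bsub>G\<^esub> (i * (2 ^ e - 1))" by simp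
      then have "x = a [^]\<^bsub>G\<^esub> (i * (2 ^ e - 1))" using a x by (simp del: nat_pow_mult)
      then show ?thesis using notin by blast
    qed
  qed
  then have "?P \<cong> G" by (auto simp: is_iso_def)
  then have "G \<cong> ?P" by (rule P.iso_sym)
  then show ?thesis using ord(2) unfolding generalized_quaternion_def by blast
qed

section \<open>Paths of incomparable elements\<close>

context p_group
begin

lemma ord_conjugate:
  assumes "g \<in> carrier G" "x \<in> carrier G"
  shows "ord (g \<otimes> x \<otimes> inv g) = ord x"
proof -
  have c: "g \<otimes> x \<otimes> inv g \<in> carrier G" using assms by simp
  have "(g \<otimes> x \<otimes> inv g) [^] n = \<one> \<longleftrightarrow> x [^] n = \<one>" for n :: nat
    using inv_solve_right'[of \<one> "g \<otimes> x [^] n" g] conjugate_pow[OF assms, of n] assms by simp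
  then show ?thesis using ord_unique[OF c, of "ord x"] pow_eq_id[OF assms(2)] by simp
qed

definition level :: "nat \<Rightarrow> 'a set" where
  "level k = {x \<in> carrier G. ord x = p ^ k}"

lemma level_carrier: "x \<in> level k \<Longrightarrow> x \<in> carrier G"
  by (simp add: level_def)

lemma finite_level: "finite (level k)"
  using fin by (simp add: level_def)

lemma card_generators:
  assumes "x \<in> level k"
  shows "card {u \<in> level k. generate G {u} = generate G {x}} = card {i. i < p ^ k \<and> coprime i (p ^ k)}"
proof -
  have x: "x \<in> carrier G" "ord x = p ^ k" using assms by (auto simp: level_def)
  have xx: "x \<in> generate G {x}" using generate.incl[of x "{x}" G] by simp
  have pk: "0 < p ^ k" using p_ge_2 by simp
  have "{u \<in> level k. generate G {u} = generate G {x}} = (\<lambda>i. x [^] i) ` {i. i < p ^ k \<and> coprime i (p ^ k)}"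
  proof (intro equalityI subsetI)
    fix u assume "u \<in> {u \<in> level k. generate G {u} = generate G {x}}"
    then have u: "u \<in> carrier G" "ord u = p ^ k" "generate G {u} = generate G {x}" by (auto simp: level_def)
    then have "u \<in> generate G {x}" using generate.incl[of u "{u}" G] by simp
    then obtain i :: nat where "u = x [^] i" using generate_singleton[OF x(1)] by auto
    then have i: "u = x [^] (i mod p ^ k)"
      using pow_eq_iff_cong[OF x(1), of i "i mod p ^ k"] x(2) by (simp add: cong_def)
    then have "coprime (i mod p ^ k) (p ^ k)"
      using pow_ord_eq_ord_iff[OF fin x(1), of "i mod p ^ k"] u(2) x(2) by simp
    then show "u \<in> (\<lambda>i. x [^] i) ` {i. i < p ^ k \<and> coprime i (p ^ k)}"
      using i pk by (intro image_eqI[of _ _ "i mod p ^ k"]) auto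
  next
    fix u assume "u \<in> (\<lambda>i. x [^] i) ` {i. i < p ^ k \<and> coprime i (p ^ k)}"
    then obtain i where i: "u = x [^] i" "coprime i (p ^ k)" by auto
    then have "ord u = ord x" using pow_ord_eq_ord_iff[OF fin x(1), of i] x(2) by simp
    moreover have "u \<in> generate G {x}" using i(1) generate_singleton[OF x(1)] by auto
    ultimately show "u \<in> {u \<in> level k. generate G {u} = generate G {x}}"
      using generate_eq_if_same_ord[OF x(1) _ xx] i(1) x by (simp add: level_def)
  qed
  moreover have "inj_on (\<lambda>i. x [^] i) {i. i < p ^ k \<and> coprime i (p ^ k)}"
    using ord_inj[OF x(1)] by (rule inj_on_subset) (auto simp: x(2))
  ultimately show ?thesis by (simp add: card_image)
qed

lemma generate_eq_if_comparable_same_level: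
  assumes "x \<in> level k" "y \<in> level k" "comparable G x y"
  shows "generate G {x} = generate G {y}"
proof -
  have *: "generate G {u} = generate G {v}" if "u \<in> level k" "v \<in> level k" "u \<in> generate G {v}" for u v
    using generate_eq_if_same_ord[of v u v] that generate.incl[of v "{v}" G] by (simp add: level_def)
  have "x \<in> generate G {y} \<or> y \<in> generate G {x}"
    using comparable_iff[OF level_carrier[OF assms(1)] level_carrier[OF assms(2)]] assms(3) by simp
  then show ?thesis
  proof
    assume "y \<in> generate G {x}"
    then show ?thesis using *[OF assms(2,1)] by simp
  qed (rule *[OF assms(1,2)])
qed

text \<open>
  Elements of equal order are comparable only if they generate the same subgroup, and all cyclic
  subgroups of the same order have equally many generators.
\<close>

lemma path_in_level:
  assumes "s \<in> level k" "\<exists>x \<in> level k. \<exists>y \<in> level k. generate G {x} \<noteq> generate G {y}"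
  shows "\<exists>xs. distinct xs \<and> set xs = level k \<and> hd xs = s \<and> successively (\<lambda>x y. \<not> comparable G x y) xs"
proof -
  have other: "\<exists>t \<in> level k. generate G {t} \<noteq> generate G {s}"
  proof (rule ccontr)
    assume "\<not> ?thesis"
    then have "generate G {t} = generate G {s}" if "t \<in> level k" for t using that by blast
    then show False using assms(2) by simp
  qed
  have "\<exists>xs. distinct xs \<and> set xs = level k \<and> hd xs = s \<and>
      successively (\<lambda>x y. generate G {x} \<noteq> generate G {y}) xs"
    by (rule round_robin[OF finite_level assms(1) other]) (simp only: card_generators)
  then obtain xs where xs: "distinct xs" "set xs = level k" "hd xs = s"
      "successively (\<lambda>x y. generate G {x} \<noteq> generate G {y}) xs" by (elim exE conjE)
  have "successively (\<lambda>x y. \<not> comparable G x y) xs"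
  proof (rule successively_mono[OF xs(4)])
    fix x y assume "x \<in> set xs" "y \<in> set xs" "generate G {x} \<noteq> generate G {y}"
    then show "\<not> comparable G x y"
      using generate_eq_if_comparable_same_level[of x k y] xs(2) by auto
  qed
  then show ?thesis using xs(1-3) by (intro exI[of _ xs] conjI)
qed

text \<open>
  A cyclic group of order \<open>p ^ Suc j\<close> contains only one subgroup of order \<open>p ^ j\<close>, so a path that has
  exhausted the elements of order \<open>p ^ Suc j\<close> can always step down to another such subgroup.
\<close>

lemma path_through_levels:
  assumes two: "\<And>k. 1 \<le> k \<Longrightarrow> k \<le> m \<Longrightarrow> \<exists>x \<in> level k. \<exists>y \<in> level k. generate G {x} \<noteq> generate G {y}"
    and "1 \<le> j" "j \<le> m" "s \<in> level j"
  shows "\<exists>xs. distinct xs \<and> set xs = (\<Union>i \<in> {1..j}. level i) \<and> hd xs = s \<and>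
    successively (\<lambda>x y. \<not> comparable G x y) xs"
  using assms(2-4)
proof (induction j arbitrary: s rule: nat_induct_at_least)
  case base
  then show ?case using path_in_level[of s 1] two[of 1] by simp
next
  case (Suc j)
  obtain xs where xs: "distinct xs" "set xs = level (Suc j)" "hd xs = s"
      "successively (\<lambda>x y. \<not> comparable G x y) xs"
    using path_in_level[OF Suc.prems(2)] two[of "Suc j"] Suc.prems(1) by auto
  have ne: "xs \<noteq> []" using xs(2) Suc.prems(2) by auto
  define u where "u = last xs"
  have u: "u \<in> level (Suc j)" using last_in_set[OF ne] xs(2) by (simp add: u_def)
  have uc: "u \<in> carrier G" "ord u = p ^ Suc j" using u by (auto simp: level_def)
  have "\<exists>v \<in> level j. generate G {v} \<noteq> generate G {u [^] p}"
    using two[of j] Suc.hyps Suc.prems(1) by (metis Suc_leD)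
  then obtain v where v: "v \<in> level j" "generate G {v} \<noteq> generate G {u [^] p}" by blast
  have vc: "v \<in> carrier G" "ord v = p ^ j" using v(1) by (auto simp: level_def)
  have nc: "\<not> comparable G u v"
  proof
    assume "comparable G u v"
    then consider "u \<in> generate G {v}" | "v \<in> generate G {u}" using comparable_iff uc vc by blast
    then show False
    proof cases
      case 1
      then have "card (generate G {u}) \<le> card (generate G {v})"
        using generate_singleton_mono[OF vc(1)] finite_generate[OF vc(1)] by (simp add: card_mono)
      then have "p ^ Suc j \<le> p ^ j" using generate_pow_card[OF uc(1)] generate_pow_card[OF vc(1)] uc vc by simp
      then show False using p_ge_2 by simp
    next
      case 2
      have "u [^] p \<in> generate G {u}" using generate_singleton[OF uc(1)] by auto
      moreover have "ord (u [^] p) = p ^ j" using ord_pow_prime_power[OF uc, of 1] by simp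
      ultimately show False using generate_eq_if_same_ord[OF uc(1) 2] vc v(2) by simp
    qed
  qed
  obtain ys where ys: "distinct ys" "set ys = (\<Union>i \<in> {1..j}. level i)" "hd ys = v"
      "successively (\<lambda>x y. \<not> comparable G x y) ys"
    using Suc.IH[OF _ v(1)] Suc.prems(1) by auto
  have "level (Suc j) \<inter> level i = {}" if "i \<le> j" for i
    using that p_ge_2 power_inject_exp[of p "Suc j" i] by (auto simp: level_def simp del: power_Suc)
  then have "set xs \<inter> set ys = {}" unfolding xs(2) ys(2) by fastforce
  then have "distinct (xs @ ys)" using xs(1) ys(1) by simp
  moreover have "set (xs @ ys) = (\<Union>i \<in> {1..Suc j}. level i)"
    using xs(2) ys(2) by (auto simp: atLeastAtMostSuc_conv)
  moreover have "hd (xs @ ys) = s" using xs(3) ne by simp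
  moreover have "successively (\<lambda>x y. \<not> comparable G x y) (xs @ ys)"
    using xs(4) ys(3,4) nc by (simp add: successively_append_iff u_def)
  ultimately show ?case by (intro exI[of _ "xs @ ys"] conjI)
qed

text \<open>
  With \<open>s\<close> prime to \<open>p\<close>, \<open>(c \<otimes> w) [^] p = c [^] (p * s)\<close>. Hence \<open>c \<otimes> w\<close> would have order \<open>p ^ k\<close> as
  well and, by uniqueness, lie in the subgroup generated by \<open>c\<close>, together with \<open>w\<close>.
\<close>

lemma not_commuting_outside_unique_level:
  assumes k: "k \<ge> 2" and c: "c \<in> level k"
    and unique: "\<And>x. x \<in> level k \<Longrightarrow> generate G {x} = generate G {c}"
    and w: "w \<in> carrier G" "ord w = p" "w \<notin> generate G {c}"
    and comm: "p = 2 \<Longrightarrow> \<exists>d \<in> generate G {c}. ord d = 4 \<and> w \<otimes> d = d \<otimes> w"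
  shows False
proof -
  have cc: "c \<in> carrier G" "ord c = p ^ k" using c by (auto simp: level_def)
  have c1: "c \<noteq> \<one>"
  proof
    assume "c = \<one>"
    then have "p ^ k = 1" using cc(2) by simp
    then show False using k p_ge_2 by (simp add: power_eq_1_iff)
  qed
  have "w \<otimes> c \<otimes> inv w \<in> level k" using ord_conjugate[OF w(1) cc(1)] cc w(1) by (simp add: level_def)
  then have nrm: "w \<otimes> c \<otimes> inv w \<in> generate G {c}"
    using unique generate.incl[of "w \<otimes> c \<otimes> inv w" "{w \<otimes> c \<otimes> inv w}" G] by blast
  have wp: "w [^] p = \<one>" using pow_eq_id[OF w(1)] w(2) by simp
  then have wpc: "w [^] p \<in> generate G {c}" using generate.one by metis
  obtain r :: nat where r: "w \<otimes> c = c [^] r \<otimes> w" "[r = 1] (mod p)" "p = 2 \<longrightarrow> [r = 1] (mod 4)"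
    using twist_exponent[OF cc(1) c1 w(1) nrm wpc] comm by blast
  obtain s where s: "(\<Sum>i<p. r ^ i) = p * s" "\<not> p dvd s" using power_sum_prime[OF prime r(2)] r(3) by blast
  have cw: "c \<otimes> w \<in> carrier G" using cc w by simp
  have "(c [^] (1::nat) \<otimes> w) [^] p = c [^] (1 * (p * s)) \<otimes> w [^] p"
    using twisted_product_pow[OF cc(1) w(1) r(1), of 1 p] by (simp only: s)
  then have pow: "(c \<otimes> w) [^] p = (c [^] p) [^] s" using cc(1) wp by (simp add: nat_pow_pow)
  have ocp: "ord (c [^] p) = p ^ (k - 1)" using ord_pow_prime_power[OF cc, of 1] k by simp
  have "coprime p s" using s(2) prime prime_imp_coprime by blast
  then have "coprime s (p ^ (k - 1))" by (simp add: coprime_commute)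
  then have "ord ((c \<otimes> w) [^] p) = p ^ (k - 1)"
    using pow_ord_eq_ord_iff[OF fin, of "c [^] p" s] cc(1) ocp pow by simp
  then have "ord (c \<otimes> w) = p ^ k" using ord_if_ord_pow[OF cw, of "k - 1"] k by simp
  then have "generate G {c \<otimes> w} = generate G {c}" using unique[of "c \<otimes> w"] cw by (simp add: level_def)
  then have "c \<otimes> w \<in> generate G {c}" using generate.incl[of "c \<otimes> w" "{c \<otimes> w}" G] by simp
  moreover have sub: "subgroup (generate G {c}) G" using cc(1) by (intro generate_is_subgroup) simp
  moreover have "c \<in> generate G {c}" using generate.incl[of c "{c}" G] by simp
  ultimately have "inv c \<otimes> (c \<otimes> w) \<in> generate G {c}"
    using subgroup.m_closed[OF sub] subgroup.m_inv_closed[OF sub] by blast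
  then show False using cc(1) w by (simp add: m_assoc[symmetric])
qed

text \<open>
  The centralizer \<open>H\<close> of \<open>d\<close> has index 2, and its only involution is \<open>z = d [^] 2\<close>. The square of an
  element outside \<open>H\<close> is \<open>1\<close> or \<open>z\<close>: if a power of the element in \<open>H\<close> had order 4, that power would
  generate the same subgroup as \<open>d\<close>, and the element would commute with \<open>d\<close>. So elements outside \<open>H\<close>
  are incomparable to all of \<open>H\<close> except \<open>1\<close> and \<open>z\<close>, and a path can alternate between the two cosets;
  \<open>z\<close> itself is placed between two involutions outside \<open>H\<close>.
\<close>

lemma path_if_centralizer_has_one_involution:
  assumes p: "p = 2" and d: "d \<in> carrier G" "ord d = 4"
    and dn: "\<And>g. g \<in> carrier G \<Longrightarrow> g \<otimes> d \<otimes> inv g \<in> generate G {d}"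
    and one_inv: "\<And>h. h \<in> carrier G \<Longrightarrow> h \<otimes> d = d \<otimes> h \<Longrightarrow> ord h = 2 \<Longrightarrow> h = d [^] (2::nat)"
    and w: "w \<in> carrier G" "ord w = 2" "w \<noteq> d [^] (2::nat)"
  shows "\<exists>xs. distinct xs \<and> set xs = carrier G - {\<one>} \<and> successively (\<lambda>x y. \<not> comparable G x y) xs"
proof -
  define z where "z = d [^] (2::nat)"
  define H where "H = {g \<in> carrier G. g \<otimes> d = d \<otimes> g}"
  note cent = centralizer_of_order_4[OF d dn, folded H_def]
  have sub: "subgroup H G" using cent(1) normal_imp_subgroup by blast
  have HG: "H \<subseteq> carrier G" by (auto simp: H_def)
  have finH: "finite H" using HG fin finite_subset by blast
  have one: "\<And>h. h \<in> H \<Longrightarrow> ord h = 2 \<Longrightarrow> h = z" using one_inv by (simp add: H_def z_def)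
  have z: "z \<in> carrier G" "z \<in> H" using d by (auto simp: z_def H_def numeral_2_eq_2 m_assoc)
  have oz: "ord z = 2" using ord_pow[OF d(1), of 2] d(2) by (simp add: z_def)
  have z1: "z \<noteq> \<one>" using oz by auto
  have wH: "w \<notin> H" using one w by (auto simp: z_def)
  have outH: "g \<otimes> h \<notin> H" if "g \<in> carrier G" "g \<notin> H" "h \<in> H" for g h
  proof
    assume "g \<otimes> h \<in> H"
    then have "(g \<otimes> h) \<otimes> inv h \<in> H"
      using that(3) subgroup.m_closed[OF sub] subgroup.m_inv_closed[OF sub] by blast
    then show False using that HG by (auto simp: m_assoc)
  qed
  have sq: "g [^] (2::nat) = \<one> \<or> g [^] (2::nat) = z" if g: "g \<in> carrier G" "g \<notin> H" for g
  proof -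
    have c2: "g [^] (2::nat) \<in> carrier G" using g by simp
    have g2H: "g [^] (2::nat) \<in> H" using cent(2)[of g g] g by (simp add: numeral_2_eq_2)
    have powH: "h [^] (i::nat) \<in> H" if "h \<in> H" for h i
      using that subgroup.m_closed[OF sub] subgroup.one_closed[OF sub] by (induction i) auto
    obtain l where l: "ord (g [^] (2::nat)) = p ^ l" using ord_prime_power[OF c2] .
    have "l < 2"
    proof (rule ccontr)
      assume "\<not> l < 2"
      define f where "f = (g [^] (2::nat)) [^] (p ^ (l - 2))"
      have of: "ord f = 4"
        unfolding f_def using ord_pow_prime_power[OF c2 l, of "l - 2"] \<open>\<not> l < 2\<close> p by simp
      have fH: "f \<in> H" unfolding f_def by (rule powH[OF g2H])
      then have fc: "f \<in> carrier G" "f \<otimes> d = d \<otimes> f" by (auto simp: H_def)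
      have "ord (f [^] (2::nat)) = 2" using ord_pow[OF fc(1), of 2] of by simp
      then have f2: "f [^] (2::nat) = z" using one powH[OF fH] by blast
      have dH: "d \<in> H" using d(1) by (simp add: H_def)
      have com: "f \<otimes> inv d = inv d \<otimes> f" using fc d(1) by (metis inv_closed inv_solve_left' inv_solve_right m_assoc m_closed)
      have fd: "f \<otimes> inv d \<in> H" using fH dH subgroup.m_closed[OF sub] subgroup.m_inv_closed[OF sub] by blast
      have fdc: "f \<otimes> inv d \<in> carrier G" using fc d by simp
      have "(f \<otimes> inv d) [^] (2::nat) = f [^] (2::nat) \<otimes> inv d [^] (2::nat)"
        using pow_mult_distrib[OF com fc(1)] d(1) by simp
      also have "inv d [^] (2::nat) = inv z" using d(1) by (simp add: z_def nat_pow_inv)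
      finally have fd2: "(f \<otimes> inv d) [^] (2::nat) = \<one>" using f2 z(1) by simp
      \<comment> \<open>\<open>f\<close> and \<open>d\<close> have the same square \<open>z\<close>, so their quotient is \<open>1\<close> or an involution in \<open>H\<close>, that is \<open>z\<close>.\<close>
      have "f \<in> generate G {d}"
      proof (cases "f \<otimes> inv d = \<one>")
        case True
        then have "f = d" using fc d(1) by (metis inv_closed inv_equality inv_inv)
        then show ?thesis using generate.incl[of d "{d}" G] by simp
      next
        case False
        then have "ord (f \<otimes> inv d) = 2" using ord_prime_iff[OF fdc] fd2 p by simp
        then have "f \<otimes> inv d = z" using one fd by blast
        then have "f = z \<otimes> d" using inv_solve_right'[of z f d] fc d(1) z(1) by simp
        then have "f = d [^] Suc 2" unfolding z_def nat_pow_Suc .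
        then show ?thesis using generate_singleton[OF d(1)] by blast
      qed
      then have "generate G {f} = generate G {d}"
        using generate.incl[of d "{d}" G] of d(2) by (intro generate_eq_if_same_ord[OF d(1)]) auto
      then have "d \<in> generate G {f}" using generate.incl[of d "{d}" G] by simp
      then obtain i :: nat where "d = f [^] i" using generate_singleton[OF fc(1)] by auto
      then have "d = g [^] (2 * p ^ (l - 2) * i)" using g by (simp add: f_def nat_pow_pow)
      then have "g \<otimes> d = d \<otimes> g" using g nat_pow_comm[OF g(1), of 1] by simp
      then show False using g by (simp add: H_def)
    qed
    then have "l = 0 \<or> l = 1" by linarith
    then show ?thesis
    proof
      assume "l = 0"
      then show ?thesis using l ord_eq_1[OF c2] by simp
    next
      assume "l = 1"
      then show ?thesis using one[OF g2H] l p by simp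
    qed
  qed
  have inc: "\<not> comparable G g h" if g: "g \<in> carrier G" "g \<notin> H" and h: "h \<in> H" "h \<noteq> \<one>" "h \<noteq> z" for g h
  proof
    have hc: "h \<in> carrier G" using h HG by blast
    assume "comparable G g h"
    then have "g \<in> generate G {h} \<or> h \<in> generate G {g}" using comparable_iff g(1) hc by blast
    then show False
    proof
      assume "g \<in> generate G {h}"
      then show False using generate_subgroup_incl[of "{h}" H] sub h(1) g(2) by blast
    next
      assume "h \<in> generate G {g}"
      then obtain i :: nat where i: "h = g [^] i" using generate_singleton[OF g(1)] by auto
      have zp: "z [^] j \<in> {\<one>, z}" for j :: nat
      proof (induction j)
        case (Suc j)
        have "z \<otimes> z = \<one>" using pow_eq_id[OF z(1), of 2] oz z(1) by (simp add: numeral_2_eq_2)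
        then show ?case using Suc z(1) by auto
      qed simp
      have g2: "(g [^] (2::nat)) [^] j \<in> {\<one>, z}" for j :: nat
        using sq[OF g] zp[of j] by auto
      show False
      proof (cases "even i")
        case True
        then obtain j where "i = 2 * j" by blast
        then have "h = (g [^] (2::nat)) [^] j" using i g(1) by (simp add: nat_pow_pow)
        then show False using g2[of j] h by auto
      next
        case False
        then obtain j where "i = 2 * j + 1" by (elim oddE)
        then have "h = g [^] Suc (2 * j)" using i by simp
        also have "\<dots> = g \<otimes> g [^] (2 * j)" by (rule nat_pow_Suc2[OF g(1)])
        finally have "h = g \<otimes> (g [^] (2::nat)) [^] j" using g(1) by (simp add: nat_pow_pow)
        moreover have "(g [^] (2::nat)) [^] j \<in> H"
          using g2[of j] z(2) subgroup.one_closed[OF sub] by auto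
        ultimately show False using outH[OF g] h(1) by simp
      qed
    qed
  qed
  have inc_z: "\<not> comparable G v z" if v: "v \<in> carrier G" "ord v = 2" "v \<noteq> z" for v
  proof
    assume "comparable G v z"
    then have "v \<in> generate G {z} \<or> z \<in> generate G {v}" using comparable_iff v(1) z(1) by blast
    moreover have "v \<noteq> \<one>" using v(2) by auto
    ultimately show False
      using involution_unique_in_generate[OF z(1) oz, of v] involution_unique_in_generate[OF v(1,2), of z] v(3) z1
      by blast
  qed
  define w' where "w' = w \<otimes> z"
  have w': "w' \<in> carrier G" "w' \<notin> H" "w' \<noteq> w" using outH[OF w(1) wH z(2)] w(1) z z1 by (auto simp: w'_def)
  have "ord w' = 2"
  proof -
    have "w \<otimes> d \<otimes> inv w = inv d"
      using conjugate_of_order_4[OF d w(1) dn[OF w(1)]] wH w(1) by (simp add: H_def)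
    then have "w \<otimes> z \<otimes> inv w = inv z"
      using conjugate_pow[OF w(1) d(1), of 2] d(1) by (simp add: z_def nat_pow_inv)
    moreover have "inv w = w"
      using pow_eq_id[OF w(1), of 2] w(1,2) inv_equality[of w w] by (simp add: numeral_2_eq_2)
    ultimately have "w \<otimes> z \<otimes> w \<otimes> z = \<one>" using z(1) by simp
    then have "w' [^] (2::nat) = \<one>" using w(1) z(1) by (simp add: w'_def numeral_2_eq_2 m_assoc)
    moreover have "w' \<noteq> \<one>" using w'(2) subgroup.one_closed[OF sub] by auto
    ultimately show ?thesis using ord_prime_iff[OF w'(1)] p by simp
  qed
  have ww: "w \<otimes> w = \<one>" using pow_eq_id[OF w(1), of 2] w(1,2) by (simp add: numeral_2_eq_2)
  have "bij_betw (\<lambda>h. h \<otimes> w) H (carrier G - H)"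
  proof (rule bij_betwI[where g = "\<lambda>g. g \<otimes> w"])
    show "(\<lambda>h. h \<otimes> w) \<in> H \<rightarrow> carrier G - H"
    proof
      fix h assume h: "h \<in> H"
      have "h \<otimes> w \<notin> H"
      proof
        assume "h \<otimes> w \<in> H"
        then have "inv h \<otimes> (h \<otimes> w) \<in> H"
          using h subgroup.m_closed[OF sub] subgroup.m_inv_closed[OF sub] by blast
        then show False using h HG w(1) wH by (auto simp: m_assoc[symmetric])
      qed
      then show "h \<otimes> w \<in> carrier G - H" using h HG w(1) by auto
    qed
    show "(\<lambda>g. g \<otimes> w) \<in> carrier G - H \<rightarrow> H" using cent(2) w(1) wH by blast
  qed (use HG w(1) ww in \<open>auto simp: m_assoc\<close>)
  then have card: "card (carrier G - H) = card H" by (metis bij_betw_same_card)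
  obtain hs where hs: "distinct hs" "set hs = H - {\<one>, z}" using finite_distinct_list[of "H - {\<one>, z}"] finH by auto
  obtain gs where gs: "distinct gs" "set gs = (carrier G - H) - {w, w'}"
    using finite_distinct_list[of "(carrier G - H) - {w, w'}"] fin by auto
  have "length hs = card H - 2"
    using distinct_card[OF hs(1)] hs(2) finH z(2) z1 subgroup.one_closed[OF sub] by (simp add: card_Diff_subset)
  moreover have "length gs = card (carrier G - H) - 2"
    using distinct_card[OF gs(1)] gs(2) fin w(1) wH w' by (simp add: card_Diff_subset)
  ultimately have len: "length hs = length gs" using card by simp
  have "\<exists>zs. distinct zs \<and> set zs = set hs \<union> set gs \<and> successively (\<lambda>x y. \<not> comparable G x y) zs \<and>
      (hs \<noteq> [] \<longrightarrow> hd zs = hd hs)"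
  proof (rule alternate[OF len _ hs(1) gs(1)])
    show "\<not> comparable G x y \<and> \<not> comparable G y x" if "x \<in> set hs" "y \<in> set gs" for x y
      using inc[of y x] that hs(2) gs(2) comparable_sym[of G x y] by simp
    show "set hs \<inter> set gs = {}" using hs(2) gs(2) by blast
  qed
  then obtain zs where zs: "distinct zs" "set zs = set hs \<union> set gs"
      "successively (\<lambda>x y. \<not> comparable G x y) zs" "hs \<noteq> [] \<longrightarrow> hd zs = hd hs" by blast
  have first: "zs = [] \<or> \<not> comparable G w' (hd zs)"
  proof (cases "hs = []")
    case True
    then show ?thesis using zs(2) len by simp
  next
    case False
    then have "hd zs \<in> H - {\<one>, z}" using zs(4) hs(2) hd_in_set by metis
    then show ?thesis using inc[OF w'(1,2)] by auto
  qed
  have "w \<noteq> z" "w' \<noteq> z" using wH w'(2) z(2) by auto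
  then have "successively (\<lambda>x y. \<not> comparable G x y) (w # z # w' # zs)"
    using inc_z[OF w(1,2)] inc_z[OF w'(1) \<open>ord w' = 2\<close>] comparable_sym[of G z w'] first zs(3)
    by (auto simp: successively_Cons)
  moreover have "distinct (w # z # w' # zs)"
    using zs(1,2) hs(2) gs(2) \<open>w \<noteq> z\<close> \<open>w' \<noteq> z\<close> w'(2,3) wH z(2) by auto
  moreover have "set (w # z # w' # zs) = carrier G - {\<one>}"
    using zs(2) hs(2) gs(2) HG w w' wH z z1 subgroup.one_closed[OF sub] by auto
  ultimately show ?thesis by (intro exI[of _ "w # z # w' # zs"] conjI)
qed

text \<open>
  If two cyclic subgroups of each order up to the exponent exist, the path descends through the levels.
  A level with a single cyclic subgroup has \<open>k \<ge> 2\<close> and forces \<open>p = 2\<close>, and then an element \<open>d\<close> of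
  order 4 in that subgroup commutes with no involution outside it.
\<close>

lemma incomparable_path:
  assumes u: "u \<in> carrier G" "ord u = p" and v: "v \<in> carrier G" "ord v = p" "v \<notin> generate G {u}"
  shows "\<exists>xs. distinct xs \<and> set xs = carrier G - {\<one>} \<and> successively (\<lambda>x y. \<not> comparable G x y) xs"
proof -
  have self: "x \<in> generate G {x}" for x using generate.incl[of x "{x}" G] by simp
  have "finite (ord ` carrier G)" "ord ` carrier G \<noteq> {}" using fin by auto
  from Max_in[OF this] obtain b where b: "Max (ord ` carrier G) = ord b" "b \<in> carrier G" by (rule imageE)
  have max: "ord x \<le> ord b" if "x \<in> carrier G" for x
    unfolding b(1)[symmetric] using fin that by (intro Max_ge) auto
  obtain m where m: "ord b = p ^ m" using ord_prime_power[OF b(2)] .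
  have m1: "1 \<le> m"
  proof (rule ccontr)
    assume "\<not> 1 \<le> m"
    then have "m = 0" by simp
    then have "p \<le> 1" using max[OF u(1)] u(2) m by simp
    then show False using p_ge_2 by simp
  qed
  define many where "many k \<longleftrightarrow> (\<exists>x \<in> level k. \<exists>y \<in> level k. generate G {x} \<noteq> generate G {y})" for k
  show ?thesis
  proof (cases "\<forall>k. 1 \<le> k \<and> k \<le> m \<longrightarrow> many k")
    case True
    have bl: "b \<in> level m" using b(2) m by (simp add: level_def)
    obtain xs where xs: "distinct xs" "set xs = (\<Union>i \<in> {1..m}. level i)"
        "successively (\<lambda>x y. \<not> comparable G x y) xs"
      using path_through_levels[OF _ m1 order_refl bl] True[unfolded many_def] by blast
    have "(\<Union>i \<in> {1..m}. level i) = carrier G - {\<one>}"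
    proof (intro equalityI subsetI)
      fix x assume "x \<in> (\<Union>i \<in> {1..m}. level i)"
      then obtain i where i: "1 \<le> i" "x \<in> carrier G" "ord x = p ^ i" by (auto simp: level_def)
      have "p ^ i \<noteq> 1" using i(1) p_ge_2 by (simp add: power_eq_1_iff)
      then have "x \<noteq> \<one>" using i(3) ord_id by metis
      then show "x \<in> carrier G - {\<one>}" using i(2) by simp
    next
      fix x assume x: "x \<in> carrier G - {\<one>}"
      obtain i where i: "ord x = p ^ i" using ord_prime_power[of x] x by auto
      have "i \<noteq> 0"
      proof
        assume "i = 0"
        then show False using i x ord_eq_1[of x] by simp
      qed
      moreover have "i \<le> m" using max[of x] x i m p_ge_2 by simp
      ultimately show "x \<in> (\<Union>i \<in> {1..m}. level i)" using x i by (auto simp: level_def)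
    qed
    then have "set xs = carrier G - {\<one>}" using xs(2) by simp
    then show ?thesis using xs(1,3) by (intro exI[of _ xs] conjI)
  next
    case False
    then obtain k where k: "1 \<le> k" "k \<le> m"
      and one: "\<not> many k" by blast
    have same: "generate G {x} = generate G {y}" if "x \<in> level k" "y \<in> level k" for x y
    proof (rule ccontr)
      assume "generate G {x} \<noteq> generate G {y}"
      then have "many k" unfolding many_def using that by (intro bexI)
      then show False using one by simp
    qed
    have "k \<noteq> 1"
    proof
      assume "k = 1"
      then have "generate G {v} = generate G {u}" using same[of v u] u v by (simp add: level_def)
      then show False using v(3) self[of v] by simp
    qed
    then have k2: "2 \<le> k" using k(1) by simp
    define c where "c = b [^] (p ^ (m - k))"
    have cc: "c \<in> carrier G" "ord c = p ^ k"
      using ord_pow_prime_power[OF b(2) m, of "m - k"] k(2) b(2) by (auto simp: c_def)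
    then have cl: "c \<in> level k" by (simp add: level_def)
    have uniq: "generate G {x} = generate G {c}" if "x \<in> level k" for x using same[OF that cl] .
    have no_comm: False if "w \<in> carrier G" "ord w = p" "w \<notin> generate G {c}"
        "p = 2 \<Longrightarrow> \<exists>d \<in> generate G {c}. ord d = 4 \<and> w \<otimes> d = d \<otimes> w" for w
      by (rule not_commuting_outside_unique_level[OF k2 cl _ that(1-3)]) (fact uniq, fact that(4))
    have "\<exists>w \<in> {u, v}. w \<notin> generate G {c}"
    proof (rule ccontr)
      assume "\<not> ?thesis"
      then have "generate G {u} = generate G {v}"
        using generate_eq_if_same_ord[OF cc(1), of u v] u(2) v(2) by simp
      then show False using v(3) self[of v] by simp
    qed
    then obtain w where w: "w \<in> carrier G" "ord w = p" "w \<notin> generate G {c}" using u v by blast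
    have p: "p = 2" using no_comm[OF w] by blast
    define d where "d = c [^] ((2::nat) ^ (k - 2))"
    have d: "d \<in> carrier G" "ord d = 4" "d \<in> generate G {c}"
      using ord_pow_prime_power[OF cc, of "k - 2"] k2 cc(1) p generate_singleton[OF cc(1)] by (auto simp: d_def)
    have sub: "generate G {d} \<subseteq> generate G {c}" using generate_singleton_mono[OF cc(1) d(3)] .
    have dn: "g \<otimes> d \<otimes> inv g \<in> generate G {d}" if g: "g \<in> carrier G" for g
    proof -
      have e: "g \<otimes> d \<otimes> inv g \<in> carrier G" using g d by simp
      have "g \<otimes> c \<otimes> inv g \<in> level k" using ord_conjugate[OF g cc(1)] cc g by (simp add: level_def)
      then have "generate G {g \<otimes> c \<otimes> inv g} = generate G {c}" by (rule uniq)
      moreover have "g \<otimes> d \<otimes> inv g \<in> generate G {g \<otimes> c \<otimes> inv g}"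
        unfolding d_def conjugate_pow[OF g cc(1)] using generate_singleton g cc(1) by auto
      ultimately have "generate G {g \<otimes> d \<otimes> inv g} = generate G {d}"
        using generate_eq_if_same_ord[OF cc(1) _ d(3)] ord_conjugate[OF g d(1)] by simp
      then show ?thesis using self[of "g \<otimes> d \<otimes> inv g"] by simp
    qed
    define z where "z = d [^] (2::nat)"
    have z: "z \<in> carrier G" "ord z = 2" "z \<in> generate G {d}"
      using ord_pow[OF d(1), of 2] d generate_singleton[OF d(1)] by (auto simp: z_def)
    have one_inv: "h = z" if h: "h \<in> carrier G" "h \<otimes> d = d \<otimes> h" "ord h = 2" for h
    proof -
      have "h \<in> generate G {c}" using no_comm[of h] h d(2,3) p by auto
      then have "generate G {h} = generate G {z}"
        using generate_eq_if_same_ord[OF cc(1), of h z] z sub h(3) by auto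
      then have "h \<in> generate G {z}" using self[of h] by simp
      moreover have "h \<noteq> \<one>" using h(3) by auto
      ultimately show ?thesis using involution_unique_in_generate[OF z(1,2)] by blast
    qed
    have "w \<noteq> z" using w(3) z(3) sub by blast
    then show ?thesis
      using path_if_centralizer_has_one_involution[OF p d(1,2) dn one_inv[unfolded z_def] w(1)] w(2) p
      unfolding z_def by blast
  qed
qed

end

theorem mainTheorem1:
  fixes G :: "('a, 'm) monoid_scheme" and p n :: nat
  assumes "prime p"
    and "group G"
    and "finite (carrier G)"
    and "n \<ge> 1"
    and "order G = p ^ n"
    and "order G \<noteq> 2"
  shows "lambda_number (power_graph G) = int (order G) \<longleftrightarrow>
    \<not> cyclic_group G \<and> \<not> generalized_quaternion G"
proof -
  interpret p_group G p n
    using assms(1,2,3,5) by (simp add: p_group_def p_group_axioms_def)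
  have "p ^ 1 \<le> p ^ n" using assms(4) p_ge_2 by (intro power_increasing) auto
  then have "order G \<ge> 2" using p_ge_2 assms(5) by simp
  then have order3: "order G \<ge> 3" using assms(6) by simp
  show ?thesis
  proof
    assume eq: "lambda_number (power_graph G) = int (order G)"
    have no_dominating: False
      if "z \<in> carrier G" "z \<noteq> \<one>\<^bsub>G\<^esub>" "\<And>g. g \<in> carrier G \<Longrightarrow> g \<noteq> \<one>\<^bsub>G\<^esub> \<Longrightarrow> comparable G z g" for z
      using lambda_number_power_graph_gt[OF assms(3) order3 that] eq by simp
    have "\<not> cyclic_group G"
    proof
      assume "cyclic_group G"
      then obtain x where x: "x \<in> carrier G" "carrier G = range (\<lambda>n::int. x [^]\<^bsub>G\<^esub> n)"
        using cyclic_group by blast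
      have gen: "carrier G = generate G {x}" using x(2) generate_pow[OF x(1)] by auto
      have "x \<noteq> \<one>\<^bsub>G\<^esub>"
      proof
        assume "x = \<one>\<^bsub>G\<^esub>"
        then have "carrier G = {\<one>\<^bsub>G\<^esub>}" using x(2) by auto
        then show False using order3 by (simp add: order_def)
      qed
      moreover have "comparable G x g" if "g \<in> carrier G" for g
        using comparable_iff[OF x(1) that] that gen by simp
      ultimately show False using no_dominating[OF x(1)] by blast
    qed
    moreover have "\<not> generalized_quaternion G"
      using generalized_quaternion_dominating[OF assms(2)] no_dominating by blast
    ultimately show "\<not> cyclic_group G \<and> \<not> generalized_quaternion G" ..
  next
    assume not: "\<not> cyclic_group G \<and> \<not> generalized_quaternion G"
    have "\<exists>u \<in> carrier G. \<exists>v \<in> carrier G. ord u = p \<and> ord v = p \<and> v \<notin> generate G {u}"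
    proof (rule ccontr)
      assume "\<not> ?thesis"
      then have unique: "v \<in> generate G {u}"
        if "u \<in> carrier G" "v \<in> carrier G" "ord u = p" "ord v = p" for u v using that by blast
      obtain k a x where k: "k \<ge> 2" and a: "a \<in> carrier G" and x: "x \<in> carrier G"
        and ord: "ord a = 2 ^ k" and xa: "x \<notin> generate G {a}"
        and rel: "x [^]\<^bsub>G\<^esub> (2::nat) = a [^]\<^bsub>G\<^esub> ((2::nat) ^ (k - 1))"
          "inv\<^bsub>G\<^esub> x \<otimes>\<^bsub>G\<^esub> a \<otimes>\<^bsub>G\<^esub> x = inv\<^bsub>G\<^esub> a"
        and cov: "\<And>g. g \<in> carrier G \<Longrightarrow> g \<in> generate G {a} \<or> g \<otimes>\<^bsub>G\<^esub> inv\<^bsub>G\<^esub> x \<in> generate G {a}"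
        using unique_order_p_subgroup[OF unique] not by blast
      have "quaternion_form a x g" if g: "g \<in> carrier G" for g
      proof (cases "g \<in> generate G {a}")
        case True
        then show ?thesis using generate_singleton[OF a] by (auto simp: quaternion_form_def)
      next
        case False
        then obtain i :: nat where "g \<otimes>\<^bsub>G\<^esub> inv\<^bsub>G\<^esub> x = a [^]\<^bsub>G\<^esub> i"
          using cov[OF g] generate_singleton[OF a] by auto
        then have "g = a [^]\<^bsub>G\<^esub> i \<otimes>\<^bsub>G\<^esub> x" using inv_solve_right'[of "a [^]\<^bsub>G\<^esub> i" g x] g a x by simp
        then show ?thesis unfolding quaternion_form_def by blast
      qed
      moreover have "x \<noteq> a [^]\<^bsub>G\<^esub> i" for i :: nat using xa generate_singleton[OF a] by auto
      ultimately have "generalized_quaternion G"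
        by (intro generalized_quaternionI[OF assms(2) a x ord k rel]) auto
      then show False using not by blast
    qed
    then obtain u v where "u \<in> carrier G" "ord u = p" "v \<in> carrier G" "ord v = p" "v \<notin> generate G {u}"
      by blast
    from incomparable_path[OF this] obtain xs where xs: "distinct xs" "set xs = carrier G - {\<one>\<^bsub>G\<^esub>}"
        "successively (\<lambda>x y. \<not> comparable G x y) xs"
      by blast
    show "lambda_number (power_graph G) = int (order G)"
      by (rule lambda_number_power_graph_if_path[OF assms(3) \<open>order G \<ge> 2\<close> xs])
  qed
qed

end
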